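(* Let $\omega=\omega(k)$ be a function tending to infinity as $k\to\infty$, and let $\varepsilon>0$ be fixed. For every sequence of finite graphs $G=G(k)$ with minimum degree at least $k$ and every $p=p(k)\ge\frac{\omega}{k}$, the random subgraph $G_p$ asymptotically almost surely contains a cycle of length at least $(1-\varepsilon)k$.
   Context: For a graph $G$ and $p\in[0,1]$, $G_p$ denotes the random subgraph of $G$ on the same vertex set obtained by keeping each edge of $G$ independently with probability $p$. The graph $G$ and $p$ are sequences indexed by $k\to\infty$, and "asymptotically almost surely" means with probability tending to $1$ as $k\to\infty$. *)

theory Defs
  imports "HOL-Probability.Probability"
begin

text \<open>Simple undirected graphs, as a vertex set together with a set of two-element edges.
  As usual, the vertex set is nonempty; for the null graph, a lower bound on
  the minimum degree would be meaningless.\<close>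

type_synonym 'a graph = "'a set \<times> 'a set set"

definition finite_graph :: "'a graph \<Rightarrow> bool" where
  "finite_graph G \<longleftrightarrow>
     finite (fst G) \<and> fst G \<noteq> {} \<and> (\<forall>e \<in> snd G. e \<subseteq> fst G \<and> card e = 2)"

definition vertex_degree :: "'a graph \<Rightarrow> 'a \<Rightarrow> nat" where
  "vertex_degree G v = card {e \<in> snd G. v \<in> e}"

definition min_degree :: "'a graph \<Rightarrow> nat" where
  "min_degree G = Min (vertex_degree G ` fst G)"

text \<open>A cycle is given by the cyclic list of its (at least three, pairwise distinct) vertices,
  so its length, the number of its edges, is the length of the list.\<close>

definition is_cycle :: "'a graph \<Rightarrow> 'a list \<Rightarrow> bool" where
  "is_cycle G c \<longleftrightarrow>
     3 \<le> length c \<and> distinct c \<and> set c \<subseteq> fst G \<and>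
     (\<forall>i < length c. {c ! i, c ! (Suc i mod length c)} \<in> snd G)"

text \<open>The coordinates of the product distribution are independent Bernoulli variables, one for each
  edge, telling whether that edge is kept. (The argument \<open>False\<close> is only the default value
  outside the edge set.)\<close>

definition random_subgraph :: "'a graph \<Rightarrow> real \<Rightarrow> 'a graph pmf" where
  "random_subgraph G p =
     map_pmf (\<lambda>keep. (fst G, {e \<in> snd G. keep e})) (Pi_pmf (snd G) False (\<lambda>_. bernoulli_pmf p))"

end

theory Submission
  imports Defs "HOL-Real_Asymp.Real_Asymp"
begin

text \<open>Following Riordan, expose \<open>G\<^sub>p\<close> as the union of two independent random subgraphs with edge
  probability \<open>q \<ge> p / 2\<close>, after thinning \<open>G\<close> to a spanning subgraph with at most \<open>n k\<close> edges.
  The first one has a rooted spanning forest without cross edges (as produced by depth-first search);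
  by a union bound over all forests, with high probability only \<open>o(n k)\<close> edges of \<open>G\<close> join vertices
  incomparable in this forest. So almost all vertices have almost \<open>k\<close> edges of \<open>G\<close> to their ancestors
  and descendants. Either many of these edges at one vertex span a distance close to \<open>k\<close>, and one of
  them in the second random subgraph closes a long cycle; or there is a very long vertical path on which
  almost every vertex has many edges to ancestors at moderate distance, and boundedly many such edges
  found in the second random subgraph form a chain of overlapping chords that yields a long cycle.\<close>

section \<open>Cycles from chords\<close>

lemma is_cycleI:
  assumes "distinct xs" "3 \<le> length xs" "set xs \<subseteq> V"
    and "successively (\<lambda>u v. {u, v} \<in> E) xs" "{last xs, hd xs} \<in> E"
  shows "is_cycle (V, E) xs"
  unfolding is_cycle_def
proof (intro conjI allI impI)
  fix i assume i: "i < length xs"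
  show "{xs ! i, xs ! (Suc i mod length xs)} \<in> snd (V, E)"
  proof (cases "Suc i < length xs")
    case True
    then show ?thesis using assms(4) by (simp add: successively_conv_nth)
  next
    case False
    then have "Suc i = length xs" using i by simp
    moreover from this have "xs ! i = last xs" "xs ! 0 = hd xs"
      by (metis diff_Suc_1 last_conv_nth list.size(3) nat.simps(3)) (metis \<open>Suc i = length xs\<close> hd_conv_nth list.size(3) nat.simps(3))
    ultimately show ?thesis using assms(5) by simp
  qed
qed (use assms in auto)

lemma successively_upt:
  assumes "\<And>i. a \<le> i \<Longrightarrow> Suc i < b \<Longrightarrow> P i (Suc i)"
  shows "successively P [a..<b]"
  using assms by (auto simp: successively_conv_nth)

text \<open>The positions up to \<open>D\<close> form a path whose first \<open>J * s\<close>
  positions are cut into blocks of size \<open>s\<close>; every block contains the start of a chord.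
  Following chord after chord, each time walking back down only to the block before the chord's end,
  collects at least \<open>s\<close> new positions per round. After \<open>M\<close> rounds the rest
  of the base path closes the cycle.\<close>

lemma cycle_from_chords:
  fixes adj :: "nat \<Rightarrow> nat \<Rightarrow> bool" and s l J D M :: nat
  assumes s: "0 < s" and M: "0 < M" and J0: "0 < J" and J: "(M + 3) * l \<le> J * s"
    and sym: "\<And>i j. adj i j \<Longrightarrow> adj j i"
    and path: "\<And>i. i < D \<Longrightarrow> adj i (Suc i)"
    and chords: "\<And>j. j < J \<Longrightarrow> \<exists>a b. j * s \<le> a \<and> a < Suc j * s \<and> a + 5 * s \<le> b \<and> b < a + l \<and>
                   b \<le> D \<and> adj a b"
  shows "\<exists>xs. distinct xs \<and> set xs \<subseteq> {..D} \<and> successively adj xs \<and> adj (last xs) (hd xs) \<and>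
           M * s \<le> length xs"
proof -
  obtain \<sigma> \<tau> where ch: "\<And>j. j < J \<Longrightarrow> j * s \<le> \<sigma> j \<and> \<sigma> j < Suc j * s \<and> \<sigma> j + 5 * s \<le> \<tau> j \<and>
      \<tau> j < \<sigma> j + l \<and> \<tau> j \<le> D \<and> adj (\<sigma> j) (\<tau> j)"
    using chords by metis
  \<comment> \<open>\<open>Q\<close> leads from the chord start \<open>\<sigma> j\<close> to \<open>b\<close>, its other vertices lie below \<open>\<sigma> j\<close>. It grows at both ends:
    by the chord from \<open>\<sigma> j\<close> and by the segment of the base path from \<open>b\<close> to the chord start in the
    block before the end of that chord.\<close>
  have inv: "\<exists>Q j b. j < J \<and> Q \<noteq> [] \<and> distinct Q \<and> successively adj Q \<and> hd Q = \<sigma> j \<and> last Q = b \<and>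
      \<sigma> j \<le> b \<and> (i > 0 \<longrightarrow> \<sigma> j < b) \<and> b \<le> D \<and> b \<le> \<sigma> j + 2 * s \<and> set Q \<subseteq> insert b {..\<sigma> j} \<and>
      \<sigma> j \<le> (i + 1) * l \<and> i * s \<le> length Q" if "i \<le> M" for i
    using that
  proof (induction i)
    case 0
    show ?case using ch[of 0] J0
      by (intro exI[of _ "[\<sigma> 0]"] exI[of _ 0] exI[of _ "\<sigma> 0"]) auto
  next
    case (Suc i)
    then obtain Q j b where Q: "j < J" "Q \<noteq> []" "distinct Q" "successively adj Q" "hd Q = \<sigma> j"
      "last Q = b" "\<sigma> j \<le> b" "b \<le> D" "b \<le> \<sigma> j + 2 * s" "set Q \<subseteq> insert b {..\<sigma> j}"
      "\<sigma> j \<le> (i + 1) * l" "i * s \<le> length Q"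
      by auto
    define b' where "b' = \<tau> j"
    \<comment> \<open>The block just before the one containing \<open>b'\<close>: its chord start
      \<open>a'\<close> lies strictly below \<open>b'\<close>, by less than \<open>2 * s\<close>.
      Since chords span at least \<open>5 * s\<close>, the segment from \<open>b\<close> to
      \<open>a'\<close> still has more than \<open>s\<close> steps.\<close>
    define j' where "j' = b' div s - 1"
    define a' where "a' = \<sigma> j'"
    define Q' where "Q' = rev (b' # Q @ [Suc b..<Suc a'])"
    have b': "\<sigma> j + 5 * s \<le> b'" "b' < \<sigma> j + l" "b' \<le> D" "adj (\<sigma> j) b'"
      using ch[OF Q(1)] by (auto simp: b'_def)
    have "5 * s \<le> b'" using b' by linarith
    then have "5 \<le> b' div s" using s by (metis div_le_mono nonzero_mult_div_cancel_right not_gr_zero)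
    then have j1: "Suc j' = b' div s" by (simp add: j'_def)
    have j2: "Suc j' * s \<le> b'" "b' < Suc j' * s + s"
      unfolding j1 using s div_times_less_eq_dividend dividend_less_div_times[of s b'] by auto
    \<comment> \<open>Each round raises the chord start by less than \<open>l\<close>, so
      \<open>(M + 3) * l \<le> J * s\<close> keeps all rounds inside the \<open>J\<close>
      blocks.\<close>
    have "(i + 2) * l \<le> (M + 3) * l" using Suc.prems by (intro mult_right_mono) auto
    then have "b' < J * s" using b' Q(11) J by (simp add: algebra_simps)
    then have "Suc j' * s < J * s" using j2 by linarith
    then have "j' < J" by (metis Suc_lessD mult_less_cancel2)
    then have a': "j' * s \<le> a'" "a' < Suc j' * s" "adj a' (\<tau> j')"
      using ch by (auto simp: a'_def)
    have a'_b': "a' < b'" "b' < a' + 2 * s" using a' j2 by (auto simp: algebra_simps)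
    have b_a': "b + s < a'" using a'_b' b' Q by linarith
    have "successively adj [Suc b..<Suc a']" using a'_b' b'
      by (intro successively_upt path) linarith
    moreover have "adj b (Suc b)" using path b_a' a'_b' b' by simp
    moreover have "hd [Suc b..<Suc a'] = Suc b" using b_a' by (simp add: upt_rec)
    ultimately have "successively adj (b' # Q @ [Suc b..<Suc a'])"
      using Q b' sym[of "\<sigma> j" b'] b_a'
      by (auto simp: successively_Cons successively_append_iff simp del: upt_Suc)
    then have "successively adj Q'" unfolding Q'_def successively_rev
      by (rule successively_mono) (use sym in auto)
    moreover have "distinct Q'" using Q a'_b' b_a' b' by (auto simp: Q'_def)
    moreover have "set Q' \<subseteq> insert b' {..a'}"
      using Q a'_b' b_a' by (auto simp: Q'_def)
    moreover have "hd Q' = a'" "last Q' = b'" using b_a' by (auto simp: Q'_def)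
    moreover have "Suc i * s \<le> length Q'" using Q b_a' by (simp add: Q'_def)
    moreover have "a' \<le> (Suc i + 1) * l" using a'_b' b' Q by simp
    ultimately show ?case using a'_b' b' \<open>j' < J\<close>
      by (intro exI[of _ Q'] exI[of _ j'] exI[of _ b']) (auto simp: a'_def Q'_def)
  qed
  from inv[of M] M obtain Q j b where Q: "j < J" "Q \<noteq> []" "distinct Q" "successively adj Q"
      "hd Q = \<sigma> j" "last Q = b" "\<sigma> j < b" "b \<le> D" "set Q \<subseteq> insert b {..\<sigma> j}" "M * s \<le> length Q"
    by auto
  \<comment> \<open>\<open>Q\<close> occupies only \<open>b\<close> and positions up to
    \<open>\<sigma> j\<close>, so the positions strictly between are free to close it. They may be
    absent, and then the closing edge is the path edge from \<open>\<sigma> j\<close> to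
    \<open>b\<close>.\<close>
  define xs where "xs = rev Q @ [Suc (\<sigma> j)..<b]"
  have ls: "last (rev Q) = \<sigma> j" using Q by (simp add: last_rev)
  have "successively adj xs"
    unfolding xs_def successively_append_iff
  proof (intro conjI)
    show "successively adj (rev Q)" unfolding successively_rev
      by (rule successively_mono[OF Q(4)]) (use sym in auto)
    show "successively adj [Suc (\<sigma> j)..<b]" using Q by (auto intro!: successively_upt path)
    show "rev Q = [] \<or> [Suc (\<sigma> j)..<b] = [] \<or> adj (last (rev Q)) (hd [Suc (\<sigma> j)..<b])"
      using Q ls path[of "\<sigma> j"] by (cases "Suc (\<sigma> j) < b") auto
  qed
  moreover have "adj (last xs) (hd xs)"
  proof (cases "Suc (\<sigma> j) = b")
    case True
    then show ?thesis using Q ls path[of "\<sigma> j"] by (auto simp: xs_def hd_rev hd_append)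
  next
    case False
    then have "last xs = b - 1" "hd xs = b" using Q by (auto simp: xs_def hd_rev)
    then show ?thesis using path[of "b - 1"] Q by auto
  qed
  moreover have "distinct xs" "set xs \<subseteq> {..D}" "M * s \<le> length xs"
    using Q by (auto simp: xs_def)
  ultimately show ?thesis by blast
qed

section \<open>Rooted forests without cross edges\<close>

text \<open>A step to the parent lowers the depth by one, which excludes cycles without an
  acyclicity axiom. At the roots, the vertices of depth 0, \<open>par\<close> may take any
  value.\<close>

locale rooted_forest =
  fixes V :: "'a set" and par :: "'a \<Rightarrow> 'a" and dep :: "'a \<Rightarrow> nat"
  assumes finite_V: "finite V"
    and par: "\<And>v. v \<in> V \<Longrightarrow> 0 < dep v \<Longrightarrow> par v \<in> V \<and> dep v = Suc (dep (par v))"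
begin

definition anc :: "'a \<Rightarrow> 'a \<Rightarrow> bool" where
  "anc u v \<longleftrightarrow> dep u \<le> dep v \<and> (par ^^ (dep v - dep u)) v = u"

definition arcs :: "('a \<times> 'a) set" where
  "arcs = {(v, par v) | v. v \<in> V \<and> 0 < dep v}"

lemma iter_par: "v \<in> V \<Longrightarrow> i \<le> dep v \<Longrightarrow> (par ^^ i) v \<in> V \<and> dep ((par ^^ i) v) = dep v - i"
proof (induction i)
  case (Suc i)
  then have "(par ^^ i) v \<in> V" "dep ((par ^^ i) v) = dep v - i" by auto
  with Suc.prems par[of "(par ^^ i) v"] show ?case by auto
qed simp

lemma anc_iter: "v \<in> V \<Longrightarrow> i \<le> dep v \<Longrightarrow> anc ((par ^^ i) v) v"
  by (simp add: anc_def iter_par)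

lemma anc_refl [simp]: "anc v v"
  by (simp add: anc_def)

lemma anc_in: "anc u v \<Longrightarrow> v \<in> V \<Longrightarrow> u \<in> V"
  unfolding anc_def using iter_par[of v "dep v - dep u"] by auto

lemma anc_dep_le: "anc u v \<Longrightarrow> dep u \<le> dep v"
  by (simp add: anc_def)

lemma anc_trans: "anc u v \<Longrightarrow> anc v w \<Longrightarrow> anc u w"
proof -
  assume uv: "anc u v" and vw: "anc v w"
  then have "dep w - dep u = (dep v - dep u) + (dep w - dep v)" by (auto simp: anc_def)
  then have "(par ^^ (dep w - dep u)) w = (par ^^ (dep v - dep u)) ((par ^^ (dep w - dep v)) w)"
    by (simp only: funpow_add comp_apply)
  with uv vw show "anc u w" by (auto simp: anc_def)
qed

lemma anc_par: "v \<in> V \<Longrightarrow> 0 < dep v \<Longrightarrow> anc (par v) v"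
  using anc_iter[of v 1] by simp

lemma anc_cases:
  assumes "v \<in> V" "anc u v"
  shows "u = v \<or> (0 < dep v \<and> anc u (par v))"
proof (cases "dep u = dep v")
  case False
  then have "0 < dep v" "dep v - dep u = Suc (dep (par v) - dep u)" "dep u \<le> dep (par v)"
    using assms par[of v] by (auto simp: anc_def)
  then show ?thesis using assms
    by (simp add: anc_def funpow_Suc_right del: funpow.simps)
qed (use assms in \<open>simp add: anc_def\<close>)

lemma anc_linear:
  assumes "v \<in> V" "anc u v" "anc u' v" "dep u \<le> dep u'"
  shows "anc u u'"
proof -
  have "dep v - dep u = (dep u' - dep u) + (dep v - dep u')" using assms by (auto simp: anc_def)
  then have "(par ^^ (dep v - dep u)) v = (par ^^ (dep u' - dep u)) ((par ^^ (dep v - dep u')) v)"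
    by (simp only: funpow_add comp_apply)
  then show ?thesis using assms by (auto simp: anc_def)
qed

lemma anc_eqI: "v \<in> V \<Longrightarrow> anc u v \<Longrightarrow> anc u' v \<Longrightarrow> dep u = dep u' \<Longrightarrow> u = u'"
  by (auto simp: anc_def)

lemma anc_iff_rtrancl:
  assumes "v \<in> V"
  shows "anc u v \<longleftrightarrow> (v, u) \<in> arcs\<^sup>*"
proof
  assume "anc u v"
  then have u: "u = (par ^^ (dep v - dep u)) v" by (simp add: anc_def)
  have "(v, (par ^^ i) v) \<in> arcs\<^sup>*" if "i \<le> dep v" for i
    using that
  proof (induction i)
    case (Suc i)
    then have "((par ^^ i) v, par ((par ^^ i) v)) \<in> arcs"
      using iter_par[OF assms, of i] by (auto simp: arcs_def)
    with Suc show ?case by (auto intro: rtrancl_into_rtrancl)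
  qed simp
  then show "(v, u) \<in> arcs\<^sup>*" using u by (metis diff_le_self)
next
  assume "(v, u) \<in> arcs\<^sup>*"
  then show "anc u v"
  proof (induction rule: rtrancl_induct)
    case (step y z)
    then show ?case by (auto simp: arcs_def intro: anc_trans anc_par)
  qed simp
qed

lemma dep_less_card:
  assumes "v \<in> V"
  shows "dep v < card V"
proof -
  have "inj_on (\<lambda>i. (par ^^ i) v) {..dep v}"
    by (rule inj_onI) (metis assms atMost_iff diff_diff_cancel iter_par)
  moreover have "(\<lambda>i. (par ^^ i) v) ` {..dep v} \<subseteq> V" using iter_par[OF assms] by auto
  ultimately have "card {..dep v} \<le> card V" using finite_V by (metis card_inj_on_le)
  then show ?thesis by simp
qed

lemma card_arcs_le: "card arcs \<le> card V"
proof -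
  have "arcs = (\<lambda>v. (v, par v)) ` {v \<in> V. 0 < dep v}" by (auto simp: arcs_def)
  then have "card arcs \<le> card {v \<in> V. 0 < dep v}" using finite_V by (simp add: card_image_le)
  also have "\<dots> \<le> card V" using finite_V by (auto intro: card_mono)
  finally show ?thesis .
qed

text \<open>Arcs point to the smaller depth, so an edge determines its arc. The union bound relies
  on this to charge one factor \<open>q\<close> per arc.\<close>

lemma inj_on_arcs: "inj_on (\<lambda>(u, v). {u, v}) arcs"
proof (rule inj_onI, clarify)
  fix u v u' v' assume *: "(u, v) \<in> arcs" "(u', v') \<in> arcs" "{u, v} = {u', v'}"
  then have "dep u = Suc (dep v)" "dep u' = Suc (dep v')" using par by (auto simp: arcs_def)
  with * show "u = u' \<and> v = v'" by (auto simp: doubleton_eq_iff)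
qed

text \<open>Since rehanging increases the sum of the depths, a rooted spanning forest that maximises this sum
  has no cross edges.\<close>

lemma rehang:
  assumes "v \<in> V" "u \<in> V" "\<not> anc v u" "dep v \<le> dep u"
  defines "par' \<equiv> par(v := u)"
    and "dep' \<equiv> (\<lambda>x. if anc v x then dep x - dep v + Suc (dep u) else dep x)"
  shows "rooted_forest V par' dep'" "sum dep V < sum dep' V"
proof -
  show "rooted_forest V par' dep'"
  proof
    fix x assume x: "x \<in> V" "0 < dep' x"
    show "par' x \<in> V \<and> dep' x = Suc (dep' (par' x))"
    proof (cases "x = v")
      case True
      then show ?thesis using assms by (auto simp: par'_def dep'_def)
    next
      case False
      \<comment> \<open>Rehanging moves the whole subtree of \<open>v\<close>: for
        \<open>x \<noteq> v\<close>, either both \<open>x\<close> and its parent lie below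
        \<open>v\<close> or neither does, so their depths shift equally.\<close>
      have "0 < dep x"
        using x False anc_cases[of x v] by (auto simp: dep'_def split: if_splits)
      then have "anc v x \<longleftrightarrow> anc v (par x)"
        using False anc_cases[OF x(1)] x anc_par anc_trans by blast
      then show ?thesis using False par[OF x(1) \<open>0 < dep x\<close>] anc_dep_le[of v "par x"]
        by (auto simp: par'_def dep'_def)
    qed
  qed (rule finite_V)
  have "dep x \<le> dep' x" for x using assms(4) by (auto simp: dep'_def)
  moreover have "dep v < dep' v" using assms(4) by (auto simp: dep'_def)
  ultimately show "sum dep V < sum dep' V"
    using assms(1) finite_V by (auto intro: sum_strict_mono_ex1)
qed

end

text \<open>Stated for a bare set of arcs because the union bound ranges over such sets. For the
  arcs of a forest, \<open>anc_iff_rtrancl\<close> identifies these as the edges between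
  incomparable vertices.\<close>

definition cross_edges :: "('a \<times> 'a) set \<Rightarrow> 'a set set \<Rightarrow> 'a set set" where
  "cross_edges A E = {e \<in> E. \<exists>u v. e = {u, v} \<and> (u, v) \<notin> A\<^sup>* \<and> (v, u) \<notin> A\<^sup>*}"

lemma ex_normal_forest:
  assumes "finite V" "\<And>e. e \<in> E \<Longrightarrow> e \<subseteq> V"
  shows "\<exists>par dep. rooted_forest V par dep \<and>
           (\<forall>(u, v) \<in> rooted_forest.arcs V par dep. {u, v} \<in> E) \<and>
           cross_edges (rooted_forest.arcs V par dep) E = {}"
proof -
  define Q where "Q = (\<lambda>(par, dep). rooted_forest V par dep \<and>
     (\<forall>v\<in>V. 0 < dep v \<longrightarrow> {v, par v} \<in> E))"
  have "Q (id, \<lambda>_. 0)" using assms(1) by (auto simp: Q_def rooted_forest_def)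
  \<comment> \<open>Depths stay below \<open>card V\<close>, so the sum of depths is bounded and a
    maximising forest exists.\<close>
  moreover have "sum (snd F) V < Suc (card V * card V)" if "Q F" for F
  proof -
    interpret rooted_forest V "fst F" "snd F" using that by (auto simp: Q_def split_beta)
    have "sum (snd F) V \<le> of_nat (card V) * card V"
      by (rule sum_bounded_above) (use dep_less_card in \<open>auto intro: less_imp_le\<close>)
    then show ?thesis by simp
  qed
  ultimately obtain F where F: "Q F" "\<And>F'. Q F' \<Longrightarrow> sum (snd F') V \<le> sum (snd F) V"
    using ex_has_greatest_nat[of Q "(id, \<lambda>_. 0)" "\<lambda>F. sum (snd F) V"] by blast
  obtain par dep where Fd: "F = (par, dep)" by (cases F)
  interpret rooted_forest V par dep using F(1) by (simp add: Q_def Fd)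
  have E: "{v, par v} \<in> E" if "v \<in> V" "0 < dep v" for v using F(1) that by (simp add: Q_def Fd)
  have cmp: "anc u v \<or> anc v u" if e: "{u, v} \<in> E" for u v
  proof -
    have *: "anc v u" if "{u, v} \<in> E" "dep v \<le> dep u" for u v
    \<comment> \<open>Otherwise \<open>v\<close> could be rehung below \<open>u\<close> along this
      edge, raising the sum of depths above its maximum.\<close>
    proof (rule ccontr)
      assume na: "\<not> anc v u"
      have uv: "u \<in> V" "v \<in> V" using that assms(2) by auto
      let ?par = "par(v := u)"
      let ?dep = "\<lambda>x. if anc v x then dep x - dep v + Suc (dep u) else dep x"
      have "{x, ?par x} \<in> E" if "x \<in> V" "0 < ?dep x" for x
      proof (cases "x = v")
        case True
        then show ?thesis using \<open>{u, v} \<in> E\<close> by (simp add: insert_commute)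
      next
        case False
        then have "0 < dep x"
          using that anc_cases[of x v] by (auto split: if_splits)
        then show ?thesis using False E that by simp
      qed
      then have "Q (?par, ?dep)" using rehang(1)[OF uv(2,1) na that(2)] by (auto simp: Q_def)
      then show False using F(2)[of "(?par, ?dep)"] rehang(2)[OF uv(2,1) na that(2)] by (simp add: Fd)
    qed
    show ?thesis using *[of u v] *[of v u] e by (cases "dep v \<le> dep u") (auto simp: insert_commute)
  qed
  have "cross_edges arcs E = {}"
  proof -
    have False if "{u, v} \<in> E" "(u, v) \<notin> arcs\<^sup>*" "(v, u) \<notin> arcs\<^sup>*" for u v
      using that cmp[of u v] anc_iff_rtrancl assms(2) by blast
    then show ?thesis by (auto simp: cross_edges_def)
  qed
  moreover have "\<forall>(u, v) \<in> arcs. {u, v} \<in> E" using E by (auto simp: arcs_def)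
  ultimately show ?thesis using rooted_forest_axioms by blast
qed

section \<open>Counting in rooted forests\<close>

lemma sum_card_filter_swap:
  assumes "finite A" "finite B"
  shows "(\<Sum>a\<in>A. card {b \<in> B. R a b}) = (\<Sum>b\<in>B. card {a \<in> A. R a b})"
proof -
  have "(\<Sum>a\<in>A. card {b \<in> B. R a b}) = (\<Sum>a\<in>A. \<Sum>b\<in>B. if R a b then 1 else 0)"
    using assms by (simp add: sum.If_cases Int_def conj_commute)
  also have "\<dots> = (\<Sum>b\<in>B. \<Sum>a\<in>A. if R a b then 1 else 0)" by (rule sum.swap)
  also have "\<dots> = (\<Sum>b\<in>B. card {a \<in> A. R a b})"
    using assms by (simp add: sum.If_cases Int_def conj_commute)
  finally show ?thesis .
qed

lemma mult_card_le_sum: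
  fixes f :: "'a \<Rightarrow> nat"
  assumes "finite A" "B \<subseteq> A" "\<And>x. x \<in> B \<Longrightarrow> c \<le> f x"
  shows "c * card B \<le> sum f A"
proof -
  have "c * card B \<le> sum f B" using sum_bounded_below[of B c f] assms(3) by (simp add: mult.commute)
  also have "\<dots> \<le> sum f A" using assms by (intro sum_mono2) auto
  finally show ?thesis .
qed

lemma card_neighbours:
  assumes "\<And>e. e \<in> E \<Longrightarrow> card e = 2"
  shows "card {u. {u, v} \<in> E} = card {e \<in> E. v \<in> e}"
proof -
  have "bij_betw (\<lambda>u. {u, v}) {u. {u, v} \<in> E} {e \<in> E. v \<in> e}"
  proof (intro bij_betwI')
    fix e assume e: "e \<in> {e \<in> E. v \<in> e}"
    then obtain x y where "e = {x, y}" using assms card_2_iff by (metis (lifting) mem_Collect_eq)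
    with e show "\<exists>u\<in>{u. {u, v} \<in> E}. e = {u, v}" by (auto simp: insert_commute)
  qed (auto simp: doubleton_eq_iff)
  then show ?thesis by (rule bij_betw_same_card)
qed

lemma finite_edges:
  assumes "finite V" "\<And>e. e \<in> E \<Longrightarrow> e \<subseteq> V \<and> card e = 2"
  shows "finite E"
  using assms by (metis PowI finite_Pow_iff rev_finite_subset subsetI)

lemma handshake:
  assumes "finite V" "finite E" "\<And>e. e \<in> E \<Longrightarrow> e \<subseteq> V \<and> card e = 2"
  shows "(\<Sum>v\<in>V. card {e \<in> E. v \<in> e}) = 2 * card E"
proof -
  have "(\<Sum>v\<in>V. card {e \<in> E. v \<in> e}) = (\<Sum>e\<in>E. card {v \<in> V. v \<in> e})"
    using assms by (intro sum_card_filter_swap)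
  also have "\<dots> = (\<Sum>e\<in>E. 2)"
  proof (rule sum.cong)
    fix e assume "e \<in> E"
    then have "{v \<in> V. v \<in> e} = e" "card e = 2" using assms(3) by auto
    then show "card {v \<in> V. v \<in> e} = 2" by simp
  qed simp
  finally show ?thesis by simp
qed

context rooted_forest
begin

text \<open>Count from the descendant's side: \<open>w\<close> has at most one ancestor at each
  distance in \<open>I\<close>. This yields all three double counts in
  \<open>ex_good_path\<close>.\<close>

lemma sum_card_desc_le:
  assumes "W \<subseteq> V" "finite I"
  shows "(\<Sum>v\<in>V. card {w \<in> W. anc v w \<and> dep w - dep v \<in> I}) \<le> card I * card W"
proof -
  have "card {v \<in> V. anc v w \<and> dep w - dep v \<in> I} \<le> card I" if "w \<in> W" for w
  proof (rule card_inj_on_le)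
    show "inj_on (\<lambda>v. dep w - dep v) {v \<in> V. anc v w \<and> dep w - dep v \<in> I}"
    proof (rule inj_onI, clarify)
      fix u v assume "anc u w" "anc v w" "dep w - dep u = dep w - dep v"
      then show "u = v" using that assms(1) anc_eqI[of w u v] anc_dep_le[of u w] anc_dep_le[of v w]
        by auto
    qed
  qed (use assms in auto)
  then have "(\<Sum>w\<in>W. card {v \<in> V. anc v w \<and> dep w - dep v \<in> I}) \<le> of_nat (card W) * card I"
    by (rule sum_bounded_above)
  then show ?thesis
    using assms finite_V finite_subset by (subst sum_card_filter_swap) (auto simp: mult.commute)
qed

lemma card_near_anc_le:
  assumes "x \<in> V"
  shows "card {u \<in> V. anc u x \<and> dep u < dep x \<and> dep x < dep u + t} \<le> t"
proof -
  have "card {u \<in> V. anc u x \<and> dep u < dep x \<and> dep x < dep u + t} \<le> card {dep x - t ..< dep x}"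
  proof (rule card_inj_on_le)
    show "inj_on dep {u \<in> V. anc u x \<and> dep u < dep x \<and> dep x < dep u + t}"
      using anc_eqI[OF assms] by (auto intro: inj_onI)
  qed auto
  then show ?thesis by simp
qed

abbreviation desc :: "'a \<Rightarrow> 'a set" where
  "desc v \<equiv> {w \<in> V. anc v w \<and> w \<noteq> v}"

text \<open>A vertex with few descendants is called poor. All proper descendants of a deepest non-poor
  vertex below \<open>v\<close> are poor.\<close>

lemma card_poor_desc:
  assumes "v \<in> V" "s \<le> card (desc v)"
  shows "s \<le> card {w \<in> V. anc v w \<and> card (desc w) < s}"
proof -
  let ?R = "{r \<in> V. anc v r \<and> s \<le> card (desc r)}"
  have "v \<in> ?R" "finite ?R" using assms finite_V by auto
  then have "Max (dep ` ?R) \<in> dep ` ?R" by (intro Max_in) blast+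
  then obtain r where r: "r \<in> ?R" "dep r = Max (dep ` ?R)" by auto
  then have r_max: "dep x \<le> dep r" if "x \<in> ?R" for x using that \<open>finite ?R\<close> by simp
  have "desc r \<subseteq> {w \<in> V. anc v w \<and> card (desc w) < s}"
  proof clarify
    fix w assume w: "w \<in> V" "anc r w" "w \<noteq> r"
    have "dep r < dep w"
      using anc_dep_le[OF w(2)] anc_eqI[of w r w] w by fastforce
    moreover have "anc v w" using r w anc_trans by blast
    ultimately show "anc v w \<and> card (desc w) < s" using r_max[of w] w by force
  qed
  then have "card (desc r) \<le> card {w \<in> V. anc v w \<and> card (desc w) < s}"
    using finite_V by (intro card_mono) auto
  then show ?thesis using r(1) by auto
qed

text \<open>Everything is counted through pairs (ancestor, descendant): a vertex has at most one ancestor at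
  each distance. Hence few poor vertices force few vertices of height below \<open>J * s\<close> (\<open>low\<close>),
  these force few vertices with many near descendants (\<open>heavy\<close>), and some long vertical path
  rarely meets the exceptional set \<open>B\<close>.\<close>

lemma ex_good_path:
  assumes "0 < s" "0 < J" "1 \<le> l" "l \<le> M * s" "l \<le> J * s" and "X \<subseteq> V"
    and poor: "\<And>v. v \<in> V \<Longrightarrow> card (desc v) < s \<Longrightarrow> v \<in> X"
    and X: "(J + 1)\<^sup>2 * (M + 2) * card X < card V"
  shows "\<exists>w\<in>V. \<forall>j<J. \<exists>i. j * s \<le> i \<and> i < Suc j * s \<and> i \<le> dep w \<and> (par ^^ i) w \<notin> X \<and>
           card {y \<in> V. anc ((par ^^ i) w) y \<and> dep y - dep ((par ^^ i) w) \<in> {1..<l}} < l + s"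
proof -
  define low where "low = {v \<in> V. \<forall>w\<in>V. anc v w \<longrightarrow> dep w < dep v + J * s}"
  define near where "near v = card {y \<in> V. anc v y \<and> dep y - dep v \<in> {1..<l}}" for v
  define heavy where "heavy = {v \<in> V - low. l + s \<le> near v}"
  define B where "B = X \<union> low \<union> heavy"
  have finX: "finite X" "finite low" "finite heavy"
    using finite_V assms(6) finite_subset by (auto simp: low_def heavy_def)
  have BV: "B \<subseteq> V" using assms(6) by (auto simp: B_def low_def heavy_def)

  \<comment> \<open>A low vertex off \<open>X\<close> is not poor, so it has at least
    \<open>s\<close> poor vertices below it. These lie in \<open>X\<close>, at distance below
    \<open>J * s\<close>.\<close>
  have "s * card (low - X) \<le> (\<Sum>v\<in>V. card {w \<in> X. anc v w \<and> dep w - dep v \<in> {..<J * s}})"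
  proof (rule mult_card_le_sum)
    fix v assume v: "v \<in> low - X"
    then have "v \<in> V" "s \<le> card (desc v)" using poor by (force simp: low_def)+
    then have "s \<le> card {w \<in> V. anc v w \<and> card (desc w) < s}" by (rule card_poor_desc)
    also have "\<dots> \<le> card {w \<in> X. anc v w \<and> dep w - dep v \<in> {..<J * s}}"
      using v poor finX anc_dep_le by (intro card_mono) (fastforce simp: low_def)+
    finally show "s \<le> card {w \<in> X. anc v w \<and> dep w - dep v \<in> {..<J * s}}" .
  qed (use finite_V in \<open>auto simp: low_def\<close>)
  also have "\<dots> \<le> s * (J * card X)"
    using sum_card_desc_le[OF assms(6), of "{..<J * s}"] by (simp add: mult_ac)
  finally have "card (low - X) \<le> J * card X" using assms(1) by simp
  moreover have "card low \<le> card (low - X) + card X"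
    using finX by (metis card_Un_le card_mono finite_Diff finite_UnI le_trans Un_Diff_cancel2 sup_ge1)
  ultimately have low: "card low \<le> (J + 1) * card X" by simp

  \<comment> \<open>The long path below a vertex that is not low supplies one descendant at each
    distance from 1 to \<open>l - 1\<close>.\<close>
  have near_ge: "l - 1 \<le> near v" if v: "v \<in> V - low" for v
  proof -
    obtain w where w: "w \<in> V" "anc v w" "dep v + J * s \<le> dep w"
      using v by (auto simp: low_def not_less)
    have "{dep v + 1..<dep v + l} \<subseteq> dep ` {y \<in> V. anc v y \<and> dep y - dep v \<in> {1..<l}}"
    proof
      fix d assume d: "d \<in> {dep v + 1..<dep v + l}"
      let ?y = "(par ^^ (dep w - d)) w"
      have "?y \<in> V" "dep ?y = d" "anc ?y w"
        using iter_par[OF w(1), of "dep w - d"] anc_iter[OF w(1), of "dep w - d"] d w(3) assms by auto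
      moreover have "anc v ?y" using anc_linear[OF w(1,2), of ?y] \<open>anc ?y w\<close> \<open>dep ?y = d\<close> d by simp
      ultimately show "d \<in> dep ` {y \<in> V. anc v y \<and> dep y - dep v \<in> {1..<l}}" using d by force
    qed
    then have "card {dep v + 1..<dep v + l} \<le> near v"
      unfolding near_def using finite_V by (intro surj_card_le) auto
    then show ?thesis by simp
  qed
  \<comment> \<open>The average of \<open>near\<close> is at most \<open>l - 1\<close>, and only low
    vertices can fall short of it; their deficit must pay for the surplus \<open>s\<close> of each
    heavy vertex.\<close>
  have "(l - 1) * card (V - low) + s * card heavy \<le>
      (\<Sum>v\<in>V - low. l - 1) + (\<Sum>v\<in>V - low. if v \<in> heavy then s else 0)"
    using finite_V by (simp add: sum.If_cases heavy_def Int_def conj_commute conj_left_commute)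
  also have "\<dots> \<le> (\<Sum>v\<in>V - low. near v)"
    unfolding sum.distrib[symmetric]
  proof (rule sum_mono)
    fix v assume "v \<in> V - low"
    then show "l - 1 + (if v \<in> heavy then s else 0) \<le> near v"
      using near_ge[of v] by (auto simp: heavy_def)
  qed
  also have "\<dots> \<le> (\<Sum>v\<in>V. near v)" using finite_V by (intro sum_mono2) auto
  also have "\<dots> \<le> (l - 1) * card V"
    using sum_card_desc_le[of V "{1..<l}"] by (simp add: near_def)
  also have "card V = card (V - low) + card low"
    using finite_V card_Diff_subset[of low V] card_mono[of V low] by (auto simp: low_def)
  finally have "s * card heavy \<le> (l - 1) * card low" by (simp add: algebra_simps)
  also have "\<dots> \<le> M * s * card low" using assms by (intro mult_right_mono) auto
  also have "\<dots> = s * (M * card low)" by simp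
  finally have heavy: "card heavy \<le> M * card low" using assms(1) by simp

  have "card B \<le> card X + card low + card heavy"
    unfolding B_def by (meson add_le_mono card_Un_le le_refl le_trans)
  also have "\<dots> \<le> card X + (M + 1) * card low" using heavy by simp
  also have "\<dots> \<le> card X + (M + 1) * ((J + 1) * card X)" using low by (intro add_mono mult_left_mono) auto
  also have "\<dots> \<le> (M + 2) * (J + 1) * card X" by (simp add: algebra_simps)
  finally have B: "card B \<le> (M + 2) * (J + 1) * card X" .
  have "card low + J * card B \<le> (J + 1) * card X + J * ((M + 2) * (J + 1) * card X)"
    using low B by (intro add_mono mult_left_mono) auto
  also have "\<dots> \<le> (J + 1)\<^sup>2 * (M + 2) * card X" by (simp add: algebra_simps power2_eq_square)
  finally have small: "card low + J * card B < card V" using X by simp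

  \<comment> \<open>If every such \<open>u\<close> had \<open>s\<close> vertices of \<open>B\<close>
    in the \<open>J * s\<close> levels starting at it, the double count would give
    \<open>card (V - low) \<le> J * card B\<close>, against \<open>small\<close>.\<close>
  have "\<exists>u\<in>V - low. card {w \<in> B. anc u w \<and> dep w - dep u \<in> {..<J * s}} < s"
  proof (rule ccontr)
    assume "\<not> ?thesis"
    then have "s * card (V - low) \<le> (\<Sum>u\<in>V. card {w \<in> B. anc u w \<and> dep w - dep u \<in> {..<J * s}})"
      using finite_V by (intro mult_card_le_sum) (auto simp: not_less)
    also have "\<dots> \<le> s * (J * card B)"
      using sum_card_desc_le[OF BV, of "{..<J * s}"] by (simp add: mult_ac)
    finally have "card (V - low) \<le> J * card B" using assms(1) by simp
    moreover have "card V \<le> card (V - low) + card low"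
      using diff_card_le_card_Diff[OF finX(2), of V] by simp
    ultimately show False using small by simp
  qed
  then obtain u where u: "u \<in> V" "u \<notin> low"
    "card {w \<in> B. anc u w \<and> dep w - dep u \<in> {..<J * s}} < s" by blast
  then obtain w' where w': "w' \<in> V" "anc u w'" "dep u + J * s \<le> dep w'"
    by (auto simp: low_def not_less)
  \<comment> \<open>The path from \<open>u\<close> down to \<open>w\<close> has exactly
    \<open>J * s\<close> vertices, that is, \<open>J\<close> full blocks; hence the
    \<open>- 1\<close>.\<close>
  define w where "w = (par ^^ (dep w' - (dep u + J * s - 1))) w'"
  have Js: "0 < J * s" using assms by simp
  have w: "w \<in> V" "dep w = dep u + J * s - 1" "anc w w'"
    using iter_par[OF w'(1), of "dep w' - (dep u + J * s - 1)"]
      anc_iter[OF w'(1), of "dep w' - (dep u + J * s - 1)"] w'(3) by (auto simp: w_def)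
  have "dep u \<le> dep w" using w(2) Js by linarith
  then have uw: "anc u w" using anc_linear[OF w'(1,2) w(3)] by simp
  show ?thesis
  proof (intro bexI[of _ w] allI impI)
    fix j assume "j < J"
    then have jJ: "Suc j * s \<le> J * s" by (intro mult_right_mono) auto
    have blk: "i \<le> dep w" "i < J * s" if "i \<in> {j * s..<Suc j * s}" for i
    proof -
      have "i < Suc j * s" using that by simp
      then show "i \<le> dep w" "i < J * s" using w(2) jJ by linarith+
    qed
    \<comment> \<open>A block has \<open>s\<close> vertices, while the whole path has fewer than
      \<open>s\<close> in \<open>B\<close>.\<close>
    have "\<exists>i\<in>{j * s..<Suc j * s}. (par ^^ i) w \<notin> B"
    proof (rule ccontr)
      assume neg: "\<not> ?thesis"
      have "card {j * s..<Suc j * s} \<le> card {w \<in> B. anc u w \<and> dep w - dep u \<in> {..<J * s}}"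
      proof (rule card_inj_on_le)
        show "inj_on (\<lambda>i. (par ^^ i) w) {j * s..<Suc j * s}"
        proof (rule inj_onI)
          fix i i' assume "i \<in> {j * s..<Suc j * s}" "i' \<in> {j * s..<Suc j * s}"
            and eq: "(par ^^ i) w = (par ^^ i') w"
          then have "i \<le> dep w" "i' \<le> dep w" using blk by auto
          then show "i = i'" using iter_par[OF w(1)] eq by (metis diff_diff_cancel)
        qed
        show "(\<lambda>i. (par ^^ i) w) ` {j * s..<Suc j * s} \<subseteq>
            {w \<in> B. anc u w \<and> dep w - dep u \<in> {..<J * s}}"
        proof clarify
          fix i assume i: "i \<in> {j * s..<Suc j * s}"
          then have "dep ((par ^^ i) w) = dep w - i" "anc ((par ^^ i) w) w"
            using iter_par[OF w(1), of i] anc_iter[OF w(1), of i] blk(1)[OF i] by auto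
          moreover have "dep u \<le> dep w - i" "dep w - i - dep u < J * s"
            using w(2) blk(2)[OF i] Js by linarith+
          ultimately have "anc u ((par ^^ i) w) \<and> dep ((par ^^ i) w) - dep u \<in> {..<J * s}"
            using anc_linear[OF w(1) uw] by simp
          then show "(par ^^ i) w \<in> B \<and> anc u ((par ^^ i) w) \<and>
              dep ((par ^^ i) w) - dep u \<in> {..<J * s}" using neg i by blast
        qed
        show "finite {w \<in> B. anc u w \<and> dep w - dep u \<in> {..<J * s}}"
          using BV finite_V finite_subset by fastforce
      qed
      then show False using u(3) by simp
    qed
    then obtain i where i: "j * s \<le> i" "i < Suc j * s" "(par ^^ i) w \<notin> B" by auto
    moreover have "i \<le> dep w" using blk(1)[of i] i by simp
    moreover from this have "near ((par ^^ i) w) < l + s"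
      using i(3) iter_par[OF w(1), of i] by (auto simp: B_def heavy_def)
    ultimately show "\<exists>i. j * s \<le> i \<and> i < Suc j * s \<and> i \<le> dep w \<and> (par ^^ i) w \<notin> X \<and>
        card {y \<in> V. anc ((par ^^ i) w) y \<and> dep y - dep ((par ^^ i) w) \<in> {1..<l}} < l + s"
      by (auto simp: B_def near_def)
  qed (rule w(1))
qed

section \<open>Cycles along vertical paths\<close>

lemma cycle_on_vertical_path:
  assumes "w \<in> V" "\<And>u v. (u, v) \<in> arcs \<Longrightarrow> {u, v} \<in> E"
    and "distinct xs" "set xs \<subseteq> {..dep w}" "3 \<le> length xs"
    and "successively (\<lambda>i j. {(par ^^ i) w, (par ^^ j) w} \<in> E) xs"
    and "{(par ^^ last xs) w, (par ^^ hd xs) w} \<in> E"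
  shows "is_cycle (V, E) (map (\<lambda>i. (par ^^ i) w) xs)"
proof (rule is_cycleI)
  have "xs \<noteq> []" using assms(5) by auto
  then show "{last (map (\<lambda>i. (par ^^ i) w) xs), hd (map (\<lambda>i. (par ^^ i) w) xs)} \<in> E"
    using assms by (simp add: last_map hd_map)
  \<comment> \<open>Position \<open>i\<close> is the vertex \<open>i\<close> steps above
    \<open>w\<close>; distinct positions have distinct depths.\<close>
  have "inj_on (\<lambda>i. (par ^^ i) w) {..dep w}"
    by (rule inj_onI) (metis assms(1) atMost_iff diff_diff_cancel iter_par)
  then show "distinct (map (\<lambda>i. (par ^^ i) w) xs)"
    using assms by (auto simp: distinct_map intro: inj_on_subset)
qed (use assms iter_par in \<open>auto simp: successively_map\<close>)

lemma path_edge: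
  assumes "w \<in> V" "\<And>u v. (u, v) \<in> arcs \<Longrightarrow> {u, v} \<in> E" "i < dep w"
  shows "{(par ^^ i) w, (par ^^ Suc i) w} \<in> E"
  using iter_par[OF assms(1), of i] assms(2)[of "(par ^^ i) w" "(par ^^ Suc i) w"] assms(3)
  by (auto simp: arcs_def)

lemma cycle_from_long_edge:
  assumes "x \<in> V" "anc y x" "dep y + l \<le> dep x" "2 \<le> l" "{x, y} \<in> E"
    and "\<And>u v. (u, v) \<in> arcs \<Longrightarrow> {u, v} \<in> E"
  shows "\<exists>c. is_cycle (V, E) c \<and> l \<le> length c"
proof -
  let ?d = "dep x - dep y"
  have y: "y = (par ^^ ?d) x" using assms(2) by (simp add: anc_def)
  \<comment> \<open>The path from \<open>x\<close> up to \<open>y\<close>, closed by the given edge;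
    \<open>2 \<le> l\<close> ensures at least three vertices.\<close>
  have "is_cycle (V, E) (map (\<lambda>i. (par ^^ i) x) [0..<Suc ?d])"
  proof (rule cycle_on_vertical_path)
    show "successively (\<lambda>i j. {(par ^^ i) x, (par ^^ j) x} \<in> E) [0..<Suc ?d]"
      by (intro successively_upt path_edge) (use assms in auto)
    have "last [0..<Suc ?d] = ?d" "hd [0..<Suc ?d] = 0" by (simp_all add: hd_upt del: upt_Suc)
    then show "{(par ^^ last [0..<Suc ?d]) x, (par ^^ hd [0..<Suc ?d]) x} \<in> E"
      using assms(5) y by (simp add: insert_commute)
  qed (use assms in auto)
  then show ?thesis using assms by (intro exI[of _ "map (\<lambda>i. (par ^^ i) x) [0..<Suc ?d]"]) simp
qed

end

section \<open>Forests with few cross edges\<close>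

context rooted_forest
begin

lemma anc_less: "v \<in> V \<Longrightarrow> anc u v \<Longrightarrow> u \<noteq> v \<Longrightarrow> dep u < dep v"
  using anc_dep_le anc_eqI[OF _ _ anc_refl] le_neq_implies_less by blast

text \<open>The constant 9 is the total slack in units of \<open>s\<close> that a vertex off the exceptional set spends:
  one unit each on cross edges, long edges, and the surplus of near descendants, five on ancestors
  at distance below \<open>5 * s\<close>, and one is left for the chords to be hit.\<close>

lemma ex_hitting_family:
  fixes E :: "'a set set" and M s :: nat
  defines "l \<equiv> (M - 9) * s" and "J \<equiv> (M + 3) * M"
  assumes E: "\<And>e. e \<in> E \<Longrightarrow> e \<subseteq> V \<and> card e = 2"
    and deg: "\<And>v. v \<in> V \<Longrightarrow> M * s \<le> card {u. {u, v} \<in> E}"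
    and cross: "2 * ((J + 1)\<^sup>2 * (M + 2)) * card (cross_edges arcs E) < card V * s"
    and s: "0 < s" and M: "11 \<le> M"
  shows "\<exists>\<F>. finite \<F> \<and> card \<F> \<le> J \<and> (\<forall>F\<in>\<F>. F \<subseteq> E \<and> s \<le> card F) \<and>
           (\<forall>E'. (\<forall>(u, v)\<in>arcs. {u, v} \<in> E') \<longrightarrow> (\<forall>F\<in>\<F>. F \<inter> E' \<noteq> {}) \<longrightarrow>
             (\<exists>c. is_cycle (V, E') c \<and> l \<le> length c))"
proof -
  let ?N = "cross_edges arcs E"
  have finE: "finite E" by (rule finite_edges[OF finite_V E])
  have N: "?N \<subseteq> E" by (auto simp: cross_edges_def)
  have nbr: "u \<in> V" "u \<noteq> v" if "{u, v} \<in> E" for u v using E[OF that] by auto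
  have J: "0 < J" "(M + 3) * l \<le> J * s" "l \<le> J * s"
  proof -
    have "(M + 3) * l \<le> (M + 3) * (M * s)" unfolding l_def by (intro mult_left_mono mult_right_mono) auto
    then show "(M + 3) * l \<le> J * s" by (simp add: J_def mult_ac)
    then show "l \<le> J * s" by (rule order.trans[rotated]) simp
  qed (use M in \<open>simp add: J_def\<close>)
  have "2 * 1 \<le> (M - 9) * s" using s M by (intro mult_mono) auto
  then have l: "2 \<le> l" by (simp add: l_def)
  have Ms: "M * s = l + 9 * s" using M by (simp add: l_def flip: add_mult_distrib)

  \<comment> \<open>The exceptional set: vertices with too many cross edges. The handshake identity
    gives \<open>s * card X \<le> 2 * card ?N\<close>, whence the factor 2 in the hypothesis on
    cross edges.\<close>
  define X where "X = {v \<in> V. s < card {u. {u, v} \<in> ?N}}"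
  define U where "U v = {u. {u, v} \<in> E \<and> (anc u v \<or> anc v u)}" for v
  have UV: "U v \<subseteq> V" for v using nbr(1) by (auto simp: U_def)
  have finU: "finite (U v)" for v by (rule finite_subset[OF UV finite_V])
  have full: "l + 8 * s \<le> card (U v)" if "v \<in> V" "v \<notin> X" for v
  proof -
    have "u \<in> U v \<union> {u. {u, v} \<in> ?N}" if "{u, v} \<in> E" for u
      using that \<open>v \<in> V\<close> nbr(1)[OF that] anc_iff_rtrancl unfolding U_def cross_edges_def by blast
    moreover have "finite {u. {u, v} \<in> ?N}"
      by (rule finite_subset[OF _ finite_V]) (use nbr(1) N in auto)
    ultimately have "card {u. {u, v} \<in> E} \<le> card (U v \<union> {u. {u, v} \<in> ?N})"
      using finU by (intro card_mono) auto
    also have "\<dots> \<le> card (U v) + card {u. {u, v} \<in> ?N}" by (rule card_Un_le)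
    finally show ?thesis using deg[OF that(1)] that Ms by (auto simp: X_def)
  qed
  have "s * card X \<le> (\<Sum>v\<in>V. card {u. {u, v} \<in> ?N})"
    using finite_V by (intro mult_card_le_sum) (auto simp: X_def)
  also have "\<dots> = (\<Sum>v\<in>V. card {e \<in> ?N. v \<in> e})"
    using N E by (intro sum.cong card_neighbours) auto
  also have "\<dots> = 2 * card ?N"
    using N E finite_V finE finite_subset[OF N] by (intro handshake) auto
  finally have "(J + 1)\<^sup>2 * (M + 2) * (s * card X) \<le> (J + 1)\<^sup>2 * (M + 2) * (2 * card ?N)"
    by (rule mult_left_mono) simp
  also have "\<dots> < card V * s" using cross by (simp only: mult_ac)
  finally have "(J + 1)\<^sup>2 * (M + 2) * card X * s < card V * s" by (simp only: mult_ac)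
  then have X: "(J + 1)\<^sup>2 * (M + 2) * card X < card V" by simp

  define long where "long v = {u. {u, v} \<in> E \<and>
      (anc u v \<and> dep u + l \<le> dep v \<or> anc v u \<and> dep v + l \<le> dep u)}" for v
  show ?thesis
  proof (cases "\<exists>v\<in>V. s \<le> card (long v)")
    \<comment> \<open>A single set suffices: any surviving long edge at \<open>v\<close> closes a
      cycle with the forest path between its ends.\<close>
    case True
    then obtain v where v: "v \<in> V" "s \<le> card (long v)" by blast
    have "card ((\<lambda>u. {u, v}) ` long v) = card (long v)"
      by (intro card_image inj_onI) (auto simp: doubleton_eq_iff)
    moreover have "\<exists>c. is_cycle (V, E') c \<and> l \<le> length c"
      if E': "\<forall>(u, v)\<in>arcs. {u, v} \<in> E'" and hit: "(\<lambda>u. {u, v}) ` long v \<inter> E' \<noteq> {}" for E'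
    proof -
      obtain u where u: "u \<in> long v" "{u, v} \<in> E'" using hit by blast
      then have "u \<in> V" using nbr(1) by (auto simp: long_def)
      then show ?thesis
        using u v(1) E' cycle_from_long_edge[of u v l E'] cycle_from_long_edge[of v u l E'] l
        by (auto simp: long_def insert_commute)
    qed
    ultimately show ?thesis using v J(1)
      by (intro exI[of _ "{(\<lambda>u. {u, v}) ` long v}"]) (auto simp: long_def)
  next
    case False
    then have long: "card (long v) < s" if "v \<in> V" for v using that by (auto simp: not_le)
    have fin_long: "finite (long v)" for v
      using finU[of v] by (rule rev_finite_subset) (auto simp: long_def U_def)
    \<comment> \<open>Off \<open>X\<close>, fewer than \<open>s\<close> long edges, fewer than
      \<open>s\<close> descendants and at most \<open>l\<close> near ancestors cannot account for
      \<open>l + 8 * s\<close> comparable neighbours.\<close>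
    have poor: "v \<in> X" if v: "v \<in> V" "card (desc v) < s" for v
    proof (rule ccontr)
      assume "v \<notin> X"
      let ?A = "{u \<in> V. anc u v \<and> dep u < dep v \<and> dep v < dep u + l}"
      have "U v \<subseteq> long v \<union> (desc v \<union> ?A)"
      proof
        fix u assume "u \<in> U v"
        then have u: "{u, v} \<in> E" "u \<in> V" "u \<noteq> v" "anc u v \<or> anc v u"
          using nbr[of u v] by (auto simp: U_def)
        show "u \<in> long v \<union> (desc v \<union> ?A)"
        proof (cases "anc v u")
          case False
          then have "anc u v" "dep u < dep v"
            using u anc_less[OF v(1)] by auto
          then show ?thesis using u by (auto simp: long_def)
        qed (use u in auto)
      qed
      then have "card (U v) \<le> card (long v \<union> (desc v \<union> ?A))"
        using fin_long finite_V by (intro card_mono) auto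
      also have "\<dots> \<le> card (long v) + (card (desc v) + card ?A)"
        by (meson add_left_mono card_Un_le le_trans)
      finally show False
        using full[OF v(1) \<open>v \<notin> X\<close>] long[OF v(1)] v(2) card_near_anc_le[OF v(1), of l] by linarith
    qed
    define good where "good w j i \<longleftrightarrow> j * s \<le> i \<and> i < Suc j * s \<and> i \<le> dep w \<and> (par ^^ i) w \<notin> X \<and>
        card {y \<in> V. anc ((par ^^ i) w) y \<and> dep y - dep ((par ^^ i) w) \<in> {1..<l}} < l + s"
      for w j i
    have "\<exists>w\<in>V. \<forall>j<J. \<exists>i. good w j i"
      unfolding good_def
      by (rule ex_good_path[OF s J(1) _ _ J(3) _ poor X]) (use l Ms in \<open>auto simp: X_def\<close>)
    then obtain w p where w: "w \<in> V" and "\<And>j. j < J \<Longrightarrow> good w j (p j)" by metis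
    then have p: "j * s \<le> p j" "p j < Suc j * s" "p j \<le> dep w" "(par ^^ p j) w \<notin> X"
      "card {y \<in> V. anc ((par ^^ p j) w) y \<and> dep y - dep ((par ^^ p j) w) \<in> {1..<l}} < l + s"
      if "j < J" for j using that by (auto simp: good_def)
    define x where "x j = (par ^^ p j) w" for j
    define T where "T j = {u. {u, x j} \<in> E \<and> anc u (x j) \<and> dep u + 5 * s \<le> dep (x j) \<and>
        dep (x j) < dep u + l}" for j
    have x: "x j \<in> V" "dep (x j) = dep w - p j" "anc (x j) w" if "j < J" for j
      using p[OF that] iter_par[OF w] anc_iter[OF w] by (auto simp: x_def)
    \<comment> \<open>From \<open>l + 8 * s\<close> comparable neighbours subtract fewer than
      \<open>s\<close> at long distance, fewer than \<open>l + s\<close> near descendants and at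
      most \<open>5 * s\<close> close ancestors.\<close>
    have T: "s \<le> card (T j)" if j: "j < J" for j
    proof -
      let ?A = "{u \<in> V. anc u (x j) \<and> dep u < dep (x j) \<and> dep (x j) < dep u + 5 * s}"
      let ?D = "{y \<in> V. anc (x j) y \<and> dep y - dep (x j) \<in> {1..<l}}"
      have finT: "finite (T j)" using finU[of "x j"] by (rule rev_finite_subset) (auto simp: T_def U_def)
      have "U (x j) \<subseteq> (long (x j) \<union> ?D) \<union> (?A \<union> T j)"
      proof
        fix u assume u: "u \<in> U (x j)"
        then have uE: "{u, x j} \<in> E" "u \<in> V" "u \<noteq> x j" using nbr[of u "x j"] by (auto simp: U_def)
        consider "anc u (x j)" | "anc (x j) u" using u by (auto simp: U_def)
        then show "u \<in> (long (x j) \<union> ?D) \<union> (?A \<union> T j)"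
        proof cases
          case 1
          then have "dep u < dep (x j)" using uE anc_less[OF x(1)[OF j]] by simp
          then show ?thesis using 1 uE by (auto simp: long_def T_def)
        next
          case 2
          then have "dep (x j) < dep u" using uE anc_less[OF uE(2)] by simp
          then show ?thesis using 2 uE by (auto simp: long_def)
        qed
      qed
      then have "card (U (x j)) \<le> card ((long (x j) \<union> ?D) \<union> (?A \<union> T j))"
        using fin_long finite_V finT by (intro card_mono) auto
      also have "\<dots> \<le> (card (long (x j)) + card ?D) + (card ?A + card (T j))"
        by (meson add_mono card_Un_le le_trans)
      finally show ?thesis
        using full[OF x(1)[OF j]] p[OF j] long[OF x(1)[OF j]] card_near_anc_le[OF x(1)[OF j], of "5 * s"]
        by (simp add: x_def)
    qed
    define \<F> where "\<F> = (\<lambda>j. (\<lambda>u. {u, x j}) ` T j) ` {..<J}"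
    have "finite \<F>" "card \<F> \<le> J"
      unfolding \<F>_def using card_image_le[of "{..<J}"] by auto
    moreover have "F \<subseteq> E \<and> s \<le> card F" if F: "F \<in> \<F>" for F
    proof -
      obtain j where j: "j < J" "F = (\<lambda>u. {u, x j}) ` T j" using F by (auto simp: \<F>_def)
      have "card F = card (T j)"
        unfolding j by (intro card_image inj_onI) (auto simp: doubleton_eq_iff)
      then show ?thesis using T[OF j(1)] j by (auto simp: T_def)
    qed
    moreover have "\<exists>c. is_cycle (V, E') c \<and> l \<le> length c"
      if arcs: "\<forall>(u, v)\<in>arcs. {u, v} \<in> E'" and hit: "\<forall>F\<in>\<F>. F \<inter> E' \<noteq> {}" for E'
    proof -
      have E': "{u, v} \<in> E'" if "(u, v) \<in> arcs" for u v using arcs that by blast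
      let ?adj = "\<lambda>i j. {(par ^^ i) w, (par ^^ j) w} \<in> E'"
      \<comment> \<open>An ancestor \<open>u\<close> of \<open>x j\<close> sits at position
        \<open>dep w - dep u\<close>, so the distance window in \<open>T\<close> is exactly the
        required range of chord spans.\<close>
      have chords: "\<exists>a b. j * s \<le> a \<and> a < Suc j * s \<and> a + 5 * s \<le> b \<and> b < a + l \<and> b \<le> dep w \<and> ?adj a b"
        if j: "j < J" for j
      proof -
        obtain u where u: "u \<in> T j" "{u, x j} \<in> E'" using hit j by (force simp: \<F>_def)
        have "anc u w" using u x(3)[OF j] anc_trans by (auto simp: T_def)
        then have uw: "u = (par ^^ (dep w - dep u)) w" by (simp add: anc_def)
        have "p j \<le> dep w" using p[OF j] by simp
        then have "p j + 5 * s \<le> dep w - dep u" "dep w - dep u < p j + l"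
          using u(1) x(2)[OF j] by (auto simp: T_def)
        moreover have "?adj (p j) (dep w - dep u)" using u(2) uw by (simp add: x_def insert_commute)
        ultimately show ?thesis using p[OF j] by (intro exI[of _ "p j"] exI[of _ "dep w - dep u"]) auto
      qed
      have "\<exists>xs. distinct xs \<and> set xs \<subseteq> {..dep w} \<and> successively ?adj xs \<and>
          ?adj (last xs) (hd xs) \<and> M * s \<le> length xs"
      proof (rule cycle_from_chords[OF s _ J(1,2)])
        show "?adj i (Suc i)" if "i < dep w" for i using path_edge[OF w] E' that by blast
      qed (use M chords in \<open>auto simp: insert_commute\<close>)
      then obtain xs where xs: "distinct xs" "set xs \<subseteq> {..dep w}" "successively ?adj xs"
        "?adj (last xs) (hd xs)" "M * s \<le> length xs" by blast
      have "is_cycle (V, E') (map (\<lambda>i. (par ^^ i) w) xs)"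
        using w E' xs Ms l s by (intro cycle_on_vertical_path) auto
      then show ?thesis using xs(5) Ms by (intro exI[of _ "map (\<lambda>i. (par ^^ i) w) xs"]) auto
    qed
    ultimately show ?thesis by (intro exI[of _ \<F>]) blast
  qed
qed

end

section \<open>Random subsets\<close>

text \<open>The edge part of \<open>random_subgraph\<close>, isolated so that restriction and union
  of rounds become operations on sets.\<close>

definition random_subset :: "'b set \<Rightarrow> real \<Rightarrow> 'b set pmf" where
  "random_subset E p = map_pmf (\<lambda>keep. {e \<in> E. keep e}) (Pi_pmf E False (\<lambda>_. bernoulli_pmf p))"

lemma random_subgraph_eq: "random_subgraph G p = map_pmf (Pair (fst G)) (random_subset (snd G) p)"
  by (simp add: random_subgraph_def random_subset_def map_pmf_comp)

lemma set_random_subset: "S \<in> set_pmf (random_subset E p) \<Longrightarrow> S \<subseteq> E"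
  by (auto simp: random_subset_def)

lemma random_subset_Int:
  assumes "finite E" "E' \<subseteq> E"
  shows "random_subset E' p = map_pmf (\<lambda>S. S \<inter> E') (random_subset E p)"
  unfolding random_subset_def Pi_pmf_subset[OF assms] map_pmf_comp
  by (intro map_pmf_cong refl) (use assms in auto)

lemma prob_random_subset:
  assumes "finite E" "A \<subseteq> E" "B \<subseteq> E" "A \<inter> B = {}" "0 \<le> p" "p \<le> 1"
  shows "measure_pmf.prob (random_subset E p) {S. A \<subseteq> S \<and> S \<inter> B = {}} = p ^ card A * (1 - p) ^ card B"
proof -
  \<comment> \<open>One condition per edge, as the product measure requires: present on
    \<open>A\<close>, absent on \<open>B\<close>, free elsewhere.\<close>
  let ?B = "\<lambda>e. if e \<in> A then {True} else if e \<in> B then {False} else UNIV"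
  have "(\<lambda>keep. {e \<in> E. keep e}) -` {S. A \<subseteq> S \<and> S \<inter> B = {}} = Pi E ?B"
    using assms(2-4) by (auto simp: Pi_def split: if_splits)
  then have "measure_pmf.prob (random_subset E p) {S. A \<subseteq> S \<and> S \<inter> B = {}} =
      (\<Prod>e\<in>E. measure_pmf.prob (bernoulli_pmf p) (?B e))"
    using assms(1) by (simp add: random_subset_def measure_Pi_pmf_Pi)
  also have "\<dots> = (\<Prod>e\<in>E. (if e \<in> A then p else 1) * (if e \<in> B then 1 - p else 1))"
    using assms by (intro prod.cong) (auto simp: measure_pmf_single)
  also have "\<dots> = p ^ card A * (1 - p) ^ card B"
    using assms(1-3) by (simp add: prod.distrib prod.If_cases Int_absorb1)
  finally show ?thesis .
qed

text \<open>An edge is missing from the union exactly when both independent rounds miss it, which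
  has probability \<open>(1 - q)\<^sup>2\<close>.\<close>

lemma random_subset_Un:
  assumes "finite E" "0 \<le> q" "q \<le> 1"
  shows "random_subset E (1 - (1 - q)\<^sup>2) =
    random_subset E q \<bind> (\<lambda>S. map_pmf (\<lambda>T. S \<union> T) (random_subset E q))"
proof -
  let ?q = "bernoulli_pmf q"
  have "(1 - q)\<^sup>2 \<le> 1" using assms by (intro power_le_one) auto
  then have p: "0 \<le> 1 - (1 - q)\<^sup>2" "1 - (1 - q)\<^sup>2 \<le> 1" by auto
  have bern: "bernoulli_pmf (1 - (1 - q)\<^sup>2) = ?q \<bind> (\<lambda>b. ?q \<bind> (\<lambda>c. return_pmf (b \<or> c)))"
  proof (rule pmf_eqI)
    fix i show "pmf (bernoulli_pmf (1 - (1 - q)\<^sup>2)) i = pmf (?q \<bind> (\<lambda>b. ?q \<bind> (\<lambda>c. return_pmf (b \<or> c)))) i"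
      using assms p by (cases i) (auto simp: pmf_bind power2_eq_square algebra_simps)
  qed
  have "Pi_pmf E False (\<lambda>_. bernoulli_pmf (1 - (1 - q)\<^sup>2)) =
      Pi_pmf E False (\<lambda>_. ?q) \<bind> (\<lambda>f. Pi_pmf E False (\<lambda>_. ?q) \<bind>
        (\<lambda>g. return_pmf (\<lambda>x. if x \<in> E then f x \<or> g x else False)))"
    unfolding bern using assms(1)
    by (simp add: Pi_pmf_bind[where d' = False])
  then show ?thesis
    by (auto simp: random_subset_def map_pmf_def bind_assoc_pmf bind_return_pmf intro!: bind_pmf_cong)
qed

text \<open>Condition on the first round \<open>S\<close>: a bad \<open>S\<close> is charged
  probability 1, any other \<open>S\<close> leaves failure probability at most
  \<open>\<beta>\<close> to the second round.\<close>

lemma sprinkling: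
  assumes "finite E" "0 \<le> q" "q \<le> 1" "0 \<le> \<beta>"
    and bad: "measure_pmf.prob (random_subset E q) {S. bad S} \<le> \<alpha>"
    and good: "\<And>S. S \<subseteq> E \<Longrightarrow> \<not> bad S \<Longrightarrow>
      measure_pmf.prob (random_subset E q) {T. \<not> good (S \<union> T)} \<le> \<beta>"
  shows "measure_pmf.prob (random_subset E (1 - (1 - q)\<^sup>2)) {S. \<not> good S} \<le> \<alpha> + \<beta>"
proof -
  let ?R = "random_subset E q"
  have "0 \<le> \<alpha>" using bad measure_nonneg order.trans by blast
  have "emeasure (random_subset E (1 - (1 - q)\<^sup>2)) {S. \<not> good S} =
      (\<integral>\<^sup>+S. emeasure (map_pmf (\<lambda>T. S \<union> T) ?R) {S. \<not> good S} \<partial>?R)"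
    by (simp add: random_subset_Un[OF assms(1-3)] emeasure_bind_pmf)
  also have "\<dots> \<le> (\<integral>\<^sup>+S. indicator {S. bad S} S + ennreal \<beta> \<partial>?R)"
  proof (intro nn_integral_mono_AE AE_pmfI)
    fix S assume "S \<in> set_pmf ?R"
    then have S: "S \<subseteq> E" by (rule set_random_subset)
    show "emeasure (map_pmf (\<lambda>T. S \<union> T) ?R) {S. \<not> good S} \<le> indicator {S. bad S} S + ennreal \<beta>"
    proof (cases "bad S")
      case True
      have "emeasure (map_pmf (\<lambda>T. S \<union> T) ?R) {S. \<not> good S} \<le> 1" by (rule measure_pmf.emeasure_le_1)
      also have "\<dots> \<le> 1 + ennreal \<beta>" by simp
      finally show ?thesis using True by simp
    next
      case False
      then show ?thesis using good[OF S False]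
        by (simp add: measure_pmf.emeasure_eq_measure ennreal_leI vimage_def)
    qed
  qed
  also have "\<dots> = emeasure ?R {S. bad S} + ennreal \<beta>"
    by (simp add: nn_integral_add)
  also have "\<dots> \<le> ennreal \<alpha> + ennreal \<beta>"
    using bad by (auto intro!: add_right_mono simp: measure_pmf.emeasure_eq_measure ennreal_leI)
  also have "\<dots> = ennreal (\<alpha> + \<beta>)" using \<open>0 \<le> \<alpha>\<close> assms(4) by (simp add: ennreal_plus)
  finally show ?thesis
    using \<open>0 \<le> \<alpha>\<close> assms(4) by (simp add: measure_pmf.emeasure_eq_measure del: ennreal_plus)
qed

lemma power_le_exp_uminus:
  assumes "0 \<le> q" "q \<le> (1::real)" "r \<le> real t"
  shows "(1 - q) ^ t \<le> exp (- q * r)"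
proof -
  have "(1 - q) ^ t \<le> exp (- q) ^ t"
    using assms exp_ge_add_one_self[of "- q"] by (intro power_mono) auto
  also have "\<dots> = exp (- q * real t)" by (simp add: exp_of_nat_mult[symmetric] mult.commute)
  also have "\<dots> \<le> exp (- q * r)" using assms by (simp add: mult_left_mono)
  finally show ?thesis .
qed

lemma prob_miss_family:
  assumes "finite E" "finite \<F>" "card \<F> \<le> J" "0 \<le> q" "q \<le> 1"
    and \<F>: "\<And>F. F \<in> \<F> \<Longrightarrow> F \<subseteq> E \<and> s \<le> card F"
  shows "measure_pmf.prob (random_subset E q) {T. \<exists>F\<in>\<F>. F \<inter> T = {}} \<le> real J * exp (- q * real s)"
proof -
  have "measure_pmf.prob (random_subset E q) {T. \<exists>F\<in>\<F>. F \<inter> T = {}} =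
      measure_pmf.prob (random_subset E q) (\<Union>F\<in>\<F>. {T. F \<inter> T = {}})"
    by (rule arg_cong[where f = "measure_pmf.prob _"]) auto
  also have "\<dots> \<le> (\<Sum>F\<in>\<F>. measure_pmf.prob (random_subset E q) {T. F \<inter> T = {}})"
    using assms(2) by (intro measure_UNION_le) auto
  also have "\<dots> \<le> of_nat (card \<F>) * exp (- q * real s)"
  proof (rule sum_bounded_above)
    fix F assume F: "F \<in> \<F>"
    have "measure_pmf.prob (random_subset E q) {T. F \<inter> T = {}} = (1 - q) ^ card F"
      using prob_random_subset[of E "{}" F q] assms \<F>[OF F] by (simp add: Int_commute)
    also have "\<dots> \<le> exp (- q * real s)"
      using assms \<F>[OF F] by (intro power_le_exp_uminus) auto
    finally show "measure_pmf.prob (random_subset E q) {T. F \<inter> T = {}} \<le> exp (- q * real s)" .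
  qed
  also have "\<dots> \<le> real J * exp (- q * real s)" using assms(3) by (intro mult_right_mono) auto
  finally show ?thesis .
qed

section \<open>Union bound over arc sets\<close>

lemma card_arcs_of_edges:
  assumes "finite V" "\<And>e. e \<in> E \<Longrightarrow> e \<subseteq> V \<and> card e = 2"
  shows "finite {(u, v). {u, v} \<in> E}" "card {(u, v). {u, v} \<in> E} = 2 * card E"
proof -
  have finE: "finite E" by (rule finite_edges[OF assms(1,2)])
  have V: "u \<in> V" "v \<in> V" if "{u, v} \<in> E" for u v using assms(2)[OF that] by auto
  have fin: "finite {u. {u, v} \<in> E}" for v by (rule finite_subset[OF _ assms(1)]) (use V in auto)
  have eq: "{(u, v). {u, v} \<in> E} = prod.swap ` (SIGMA v:V. {u. {u, v} \<in> E})"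
    using V by (auto simp: image_iff insert_commute)
  show "finite {(u, v). {u, v} \<in> E}" unfolding eq using assms(1) fin by auto
  have "card {(u, v). {u, v} \<in> E} = card (SIGMA v:V. {u. {u, v} \<in> E})"
    unfolding eq by (intro card_image) auto
  also have "\<dots> = (\<Sum>v\<in>V. card {u. {u, v} \<in> E})" using assms(1) fin by simp
  also have "\<dots> = (\<Sum>v\<in>V. card {e \<in> E. v \<in> e})"
    using assms(2) by (intro sum.cong card_neighbours) auto
  also have "\<dots> = 2 * card E" using assms finE by (intro handshake) auto
  finally show "card {(u, v). {u, v} \<in> E} = 2 * card E" .
qed

text \<open>A union bound over all arc sets \<open>A\<close>; weighting the term of \<open>A\<close> by
  \<open>x ^ card A / x ^ n \<ge> 1\<close> with \<open>x = 1 / (q K)\<close> turns the sum into a product over the arcs.\<close>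

lemma prob_many_cross_edges:
  fixes q K r :: real and n :: nat
  assumes "finite V" "\<And>e. e \<in> E \<Longrightarrow> e \<subseteq> V \<and> card e = 2" "real (card E) \<le> real n * K"
    and q: "0 < q" "q \<le> 1" "1 \<le> q * K"
  shows "measure_pmf.prob (random_subset E q)
     {S. \<exists>A. card A \<le> n \<and> inj_on (\<lambda>(u, v). {u, v}) A \<and> (\<forall>(u, v)\<in>A. {u, v} \<in> S) \<and>
          cross_edges A S = {} \<and> r \<le> real (card (cross_edges A E))}
     \<le> (q * K * exp 2) ^ n * exp (- q * r)"
proof -
  let ?R = "random_subset E q"
  define D where "D = {(u, v). {u, v} \<in> E}"
  define \<A> where "\<A> = {A \<in> Pow D. card A \<le> n \<and> inj_on (\<lambda>(u, v). {u, v}) A \<and>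
      r \<le> real (card (cross_edges A E))}"
  define und where "und A = (\<lambda>(u, v). {u, v}) ` A" for A :: "('a \<times> 'a) set"
  define x where "x = 1 / (q * K)"
  have finD: "finite D" and cardD: "card D = 2 * card E"
    using card_arcs_of_edges[OF assms(1,2)] by (auto simp: D_def)
  have finE: "finite E" by (rule finite_edges[OF assms(1,2)])
  have x: "0 < x" "x \<le> 1" using q by (auto simp: x_def)
  have "measure_pmf.prob ?R {S. \<exists>A. card A \<le> n \<and> inj_on (\<lambda>(u, v). {u, v}) A \<and>
        (\<forall>(u, v)\<in>A. {u, v} \<in> S) \<and> cross_edges A S = {} \<and> r \<le> real (card (cross_edges A E))}
      \<le> measure_pmf.prob ?R (\<Union>A\<in>\<A>. {S. und A \<subseteq> S \<and> S \<inter> cross_edges A E = {}})"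
  proof (rule measure_pmf.finite_measure_mono_AE)
    show "AE S in ?R. S \<in> {S. \<exists>A. card A \<le> n \<and> inj_on (\<lambda>(u, v). {u, v}) A \<and>
        (\<forall>(u, v)\<in>A. {u, v} \<in> S) \<and> cross_edges A S = {} \<and> r \<le> real (card (cross_edges A E))} \<longrightarrow>
        S \<in> (\<Union>A\<in>\<A>. {S. und A \<subseteq> S \<and> S \<inter> cross_edges A E = {}})"
    proof (intro AE_pmfI impI)
      fix S assume "S \<in> set_pmf ?R" and *: "S \<in> {S. \<exists>A. card A \<le> n \<and> inj_on (\<lambda>(u, v). {u, v}) A \<and>
        (\<forall>(u, v)\<in>A. {u, v} \<in> S) \<and> cross_edges A S = {} \<and> r \<le> real (card (cross_edges A E))}"
      then have S: "S \<subseteq> E" using set_random_subset by blast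
      from * obtain A where A: "card A \<le> n" "inj_on (\<lambda>(u, v). {u, v}) A" "\<forall>(u, v)\<in>A. {u, v} \<in> S"
        "cross_edges A S = {}" "r \<le> real (card (cross_edges A E))" by blast
      have "A \<in> \<A>" using A S by (auto simp: \<A>_def D_def)
      moreover have "und A \<subseteq> S" using A(3) by (auto simp: und_def)
      \<comment> \<open>Being a cross edge depends on \<open>A\<close> alone, so all cross edges of
        \<open>E\<close> must be missing from \<open>S\<close>.\<close>
      moreover have "S \<inter> cross_edges A E = {}" using A(4) by (auto simp: cross_edges_def)
      ultimately show "S \<in> (\<Union>A\<in>\<A>. {S. und A \<subseteq> S \<and> S \<inter> cross_edges A E = {}})" by blast
    qed
  qed auto
  also have "\<dots> \<le> (\<Sum>A\<in>\<A>. measure_pmf.prob ?R {S. und A \<subseteq> S \<and> S \<inter> cross_edges A E = {}})"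
    using finD by (intro measure_UNION_le) (auto simp: \<A>_def)
  also have "\<dots> \<le> (\<Sum>A\<in>\<A>. (x * q) ^ card A * (1 / x ^ n * exp (- q * r)))"
  proof (rule sum_mono)
    fix A assume A: "A \<in> \<A>"
    \<comment> \<open>The ends of an arc are comparable, so the edges required present and those
      required absent are disjoint.\<close>
    have "und A \<inter> cross_edges A E = {}"
      by (auto simp: und_def cross_edges_def doubleton_eq_iff)
    moreover have "und A \<subseteq> E" using A by (auto simp: und_def \<A>_def D_def)
    ultimately have "measure_pmf.prob ?R {S. und A \<subseteq> S \<and> S \<inter> cross_edges A E = {}} =
        q ^ card (und A) * (1 - q) ^ card (cross_edges A E)"
      using finE q by (intro prob_random_subset) (auto simp: cross_edges_def)
    also have "card (und A) = card A" using A by (auto simp: und_def \<A>_def card_image)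
    also have "q ^ card A * (1 - q) ^ card (cross_edges A E) \<le> q ^ card A * exp (- q * r)"
      using A q by (intro mult_left_mono power_le_exp_uminus) (auto simp: \<A>_def)
    also have "\<dots> \<le> q ^ card A * exp (- q * r) * (x ^ card A / x ^ n)"
    proof -
      have "x ^ n \<le> x ^ card A" using x A by (intro power_decreasing) (auto simp: \<A>_def)
      then have "1 \<le> x ^ card A / x ^ n" using x by simp
      then show ?thesis using q mult_left_mono[of 1 "x ^ card A / x ^ n" "q ^ card A * exp (- q * r)"] by simp
    qed
    also have "\<dots> = (x * q) ^ card A * (1 / x ^ n * exp (- q * r))" by (simp add: power_mult_distrib)
    finally show "measure_pmf.prob ?R {S. und A \<subseteq> S \<and> S \<inter> cross_edges A E = {}}
        \<le> (x * q) ^ card A * (1 / x ^ n * exp (- q * r))" .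
  qed
  also have "\<dots> \<le> (\<Sum>A\<in>Pow D. (x * q) ^ card A * (1 / x ^ n * exp (- q * r)))"
    using finD x q by (intro sum_mono2) (auto simp: \<A>_def)
  also have "\<dots> = (\<Sum>A\<in>Pow D. (x * q) ^ card A) * (1 / x ^ n * exp (- q * r))"
    by (simp only: sum_distrib_right)
  also have "(\<Sum>A\<in>Pow D. (x * q) ^ card A) = (x * q + 1) ^ (2 * card E)"
    using prod_add[OF finD, of "\<lambda>_. x * q" "\<lambda>_. 1"] by (simp add: cardD)
  also have "(x * q + 1) ^ (2 * card E) * (1 / x ^ n * exp (- q * r))
      \<le> exp 2 ^ n * (1 / x ^ n * exp (- q * r))"
  proof (rule mult_right_mono)
    have "(x * q + 1) ^ (2 * card E) \<le> exp (x * q) ^ (2 * card E)"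
      using exp_ge_add_one_self[of "x * q"] x q by (intro power_mono) (auto simp: add.commute)
    also have "\<dots> = exp (2 * (x * q * real (card E)))"
      by (simp add: exp_of_nat_mult[symmetric] mult_ac)
    \<comment> \<open>Since \<open>x * q = 1 / K\<close>, the sparsity bound on
      \<open>card E\<close> brings the exponent down to \<open>2 * n\<close>.\<close>
    also have "\<dots> \<le> exp (2 * real n)"
    proof -
      have "x * q * real (card E) \<le> x * q * (real n * K)"
        using assms(3) x q by (intro mult_left_mono) auto
      also have "\<dots> = real n" using q by (auto simp: x_def)
      finally show ?thesis by simp
    qed
    also have "\<dots> = exp 2 ^ n" by (simp add: exp_of_nat_mult[symmetric] mult.commute)
    finally show "(x * q + 1) ^ (2 * card E) \<le> exp 2 ^ n" .
  qed (use x in auto)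
  also have "\<dots> = (q * K * exp 2) ^ n * exp (- q * r)"
    by (simp add: x_def power_mult_distrib power_divide)
  finally show ?thesis .
qed

text \<open>In an edge-minimal spanning subgraph of minimum degree at least \<open>K\<close>, every edge has an endpoint
  of degree exactly \<open>K\<close>.\<close>

lemma ex_sparse_subgraph:
  assumes "finite V" "\<And>e. e \<in> E \<Longrightarrow> e \<subseteq> V \<and> card e = 2"
    and "\<And>v. v \<in> V \<Longrightarrow> K \<le> card {e \<in> E. v \<in> e}"
  shows "\<exists>E'\<subseteq>E. (\<forall>v\<in>V. K \<le> card {e \<in> E'. v \<in> e}) \<and> card E' \<le> card V * K"
proof -
  have finE: "finite E" by (rule finite_edges[OF assms(1,2)])
  define Q where "Q E' \<longleftrightarrow> E' \<subseteq> E \<and> (\<forall>v\<in>V. K \<le> card {e \<in> E'. v \<in> e})" for E'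
  have "Q E" using assms(3) by (simp add: Q_def)
  then obtain E' where E': "Q E'" "\<And>F. Q F \<Longrightarrow> card E' \<le> card F"
    using ex_has_least_nat[of Q E card] by blast
  have fin: "finite E'" using E'(1) finE finite_subset by (auto simp: Q_def)
  have tight: "\<exists>v\<in>V. v \<in> e \<and> card {e \<in> E'. v \<in> e} = K" if e: "e \<in> E'" for e
  proof (rule ccontr)
    assume neg: "\<not> ?thesis"
    have "Q (E' - {e})"
      unfolding Q_def
    proof (intro conjI ballI)
      fix v assume v: "v \<in> V"
      have K: "K \<le> card {e \<in> E'. v \<in> e}" using E'(1) v by (simp add: Q_def)
      have eq: "{f \<in> E' - {e}. v \<in> f} = {f \<in> E'. v \<in> f} - {e}" by auto
      show "K \<le> card {f \<in> E' - {e}. v \<in> f}"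
      proof (cases "v \<in> e")
        case True
        then have "K < card {e \<in> E'. v \<in> e}" using neg v K by fastforce
        then show ?thesis unfolding eq using True e fin by (simp add: card_Diff_singleton)
      next
        case False
        then show ?thesis unfolding eq using K by simp
      qed
    qed (use E'(1) in \<open>auto simp: Q_def\<close>)
    then have "card E' \<le> card (E' - {e})" by (rule E'(2))
    then show False using e fin by (metis card_Diff1_less not_less)
  qed
  define W where "W = {v \<in> V. card {e \<in> E'. v \<in> e} = K}"
  \<comment> \<open>Charge each edge to a tight endpoint; each such vertex receives at most
    \<open>K\<close> charges.\<close>
  have "E' \<subseteq> (\<Union>v\<in>W. {e \<in> E'. v \<in> e})" using tight by (auto simp: W_def)
  then have "card E' \<le> card (\<Union>v\<in>W. {e \<in> E'. v \<in> e})"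
    using fin assms(1) by (intro card_mono) (auto simp: W_def)
  also have "\<dots> \<le> (\<Sum>v\<in>W. card {e \<in> E'. v \<in> e})"
    using assms(1) by (intro card_UN_le) (auto simp: W_def)
  also have "\<dots> = card W * K" by (simp add: W_def)
  also have "\<dots> \<le> card V * K" using assms(1) by (intro mult_right_mono card_mono) (auto simp: W_def)
  finally show ?thesis using E'(1) by (auto simp: Q_def)
qed

section \<open>Long cycles in random subgraphs\<close>

lemma is_cycle_mono: "is_cycle (V, E) c \<Longrightarrow> E \<subseteq> E' \<Longrightarrow> is_cycle (V, E') c"
  by (auto simp: is_cycle_def)

text \<open>The first round fixes a normal forest, and with it a hitting family of at most
  \<open>J\<close> sets; the second round must meet every set of the family. The two error terms
  belong to the two rounds.\<close>

lemma prob_no_long_cycle: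
  fixes V :: "'a set" and M s :: nat and q :: real
  defines "J \<equiv> (M + 3) * M"
  defines "\<Delta> \<equiv> 2 * ((J + 1)\<^sup>2 * (M + 2))"
  assumes V: "finite V" "V \<noteq> {}" and E: "\<And>e. e \<in> E \<Longrightarrow> e \<subseteq> V \<and> card e = 2"
    and deg: "\<And>v. v \<in> V \<Longrightarrow> M * s \<le> card {e \<in> E. v \<in> e}"
    and card_E: "card E \<le> card V * (M * s)"
    and s: "0 < s" and M: "11 \<le> M" and q: "0 < q" "q \<le> 1" "1 \<le> q * real (M * s)"
    and small: "q * real (M * s) * exp (2 - q * real s / \<Delta>) \<le> 1"
  shows "measure_pmf.prob (random_subset E (1 - (1 - q)\<^sup>2))
           {S. \<not> (\<exists>c. is_cycle (V, S) c \<and> (M - 9) * s \<le> length c)}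
         \<le> q * real (M * s) * exp (2 - q * real s / \<Delta>) + real J * exp (- q * real s)"
proof (rule sprinkling)
  let ?n = "card V"
  \<comment> \<open>The largest number of cross edges that \<open>ex_hitting_family\<close>
    tolerates, namely \<open>card V * s / \<Delta>\<close>.\<close>
  let ?r = "real ?n * (real s / real \<Delta>)"
  let ?b = "q * real (M * s) * exp (2 - q * real s / \<Delta>)"
  let ?bad = "\<lambda>S. \<exists>A. card A \<le> ?n \<and> inj_on (\<lambda>(u, v). {u, v}) A \<and> (\<forall>(u, v)\<in>A. {u, v} \<in> S) \<and>
          cross_edges A S = {} \<and> ?r \<le> real (card (cross_edges A E))"
  show finE: "finite E" by (rule finite_edges[OF V(1) E])
  have "0 < \<Delta>" by (simp add: \<Delta>_def)
  have "measure_pmf.prob (random_subset E q) {S. ?bad S}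
      \<le> (q * real (M * s) * exp 2) ^ ?n * exp (- q * ?r)"
  proof (rule prob_many_cross_edges)
    have "real (card E) \<le> real (card V * (M * s))" using card_E by (rule of_nat_mono)
    then show "real (card E) \<le> real (card V) * real (M * s)" by simp
  qed (use V E q in auto)
  also have "exp (- q * ?r) = exp (- (q * real s / \<Delta>)) ^ ?n"
    by (simp add: exp_of_nat_mult[symmetric])
  also have "(q * real (M * s) * exp 2) ^ ?n * \<dots> = ?b ^ ?n"
    unfolding power_mult_distrib[symmetric] by (simp add: mult.assoc exp_add[symmetric])
  \<comment> \<open>As \<open>?b \<le> 1\<close> and \<open>V\<close> is nonempty, the bound becomes
    independent of the number of vertices.\<close>
  also have "\<dots> \<le> ?b ^ 1"
    using V small q by (intro power_decreasing) (auto simp: Suc_le_eq card_gt_0_iff)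
  finally show "measure_pmf.prob (random_subset E q) {S. ?bad S} \<le> ?b" by simp

  fix S assume S: "S \<subseteq> E" "\<not> ?bad S"
  obtain par dep where "rooted_forest V par dep"
    and arcs: "\<forall>(u, v) \<in> rooted_forest.arcs V par dep. {u, v} \<in> S"
    and normal: "cross_edges (rooted_forest.arcs V par dep) S = {}"
    using ex_normal_forest[OF V(1), of S] S(1) E by blast
  then interpret rooted_forest V par dep by simp
  \<comment> \<open>Otherwise \<open>arcs\<close> itself would witness that \<open>S\<close> is
    bad.\<close>
  have "\<not> ?r \<le> real (card (cross_edges arcs E))"
    using S(2) card_arcs_le inj_on_arcs arcs normal by blast
  then have "real \<Delta> * real (card (cross_edges arcs E)) < real ?n * real s"
    using \<open>0 < \<Delta>\<close> by (simp add: field_simps)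
  then have "\<Delta> * card (cross_edges arcs E) < ?n * s"
    by (simp flip: of_nat_mult)
  then have few: "2 * ((J + 1)\<^sup>2 * (M + 2)) * card (cross_edges arcs E) < ?n * s"
    by (simp only: \<Delta>_def)
  have deg': "M * s \<le> card {u. {u, v} \<in> E}" if "v \<in> V" for v
    using deg[OF that] card_neighbours[of E v] E by simp
  have "\<exists>\<F>. finite \<F> \<and> card \<F> \<le> J \<and> (\<forall>F\<in>\<F>. F \<subseteq> E \<and> s \<le> card F) \<and>
           (\<forall>E'. (\<forall>(u, v)\<in>arcs. {u, v} \<in> E') \<longrightarrow> (\<forall>F\<in>\<F>. F \<inter> E' \<noteq> {}) \<longrightarrow>
             (\<exists>c. is_cycle (V, E') c \<and> (M - 9) * s \<le> length c))"
    unfolding J_def by (rule ex_hitting_family[OF E deg' few[unfolded J_def] s M])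
  then obtain \<F> where \<F>: "finite \<F>" "card \<F> \<le> J" "\<And>F. F \<in> \<F> \<Longrightarrow> F \<subseteq> E \<and> s \<le> card F"
    and cyc: "\<And>E'. \<forall>(u, v)\<in>arcs. {u, v} \<in> E' \<Longrightarrow> \<forall>F\<in>\<F>. F \<inter> E' \<noteq> {} \<Longrightarrow>
             \<exists>c. is_cycle (V, E') c \<and> (M - 9) * s \<le> length c"
    by metis
  have "measure_pmf.prob (random_subset E q)
      {T. \<not> (\<exists>c. is_cycle (V, S \<union> T) c \<and> (M - 9) * s \<le> length c)}
      \<le> measure_pmf.prob (random_subset E q) {T. \<exists>F\<in>\<F>. F \<inter> T = {}}"
  proof (rule measure_pmf.finite_measure_mono)
    show "{T. \<not> (\<exists>c. is_cycle (V, S \<union> T) c \<and> (M - 9) * s \<le> length c)} \<subseteq> {T. \<exists>F\<in>\<F>. F \<inter> T = {}}"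
    proof (intro subsetI CollectI, rule ccontr)
      fix T assume T: "T \<in> {T. \<not> (\<exists>c. is_cycle (V, S \<union> T) c \<and> (M - 9) * s \<le> length c)}"
        and "\<not> (\<exists>F\<in>\<F>. F \<inter> T = {})"
      then have "\<forall>F\<in>\<F>. F \<inter> (S \<union> T) \<noteq> {}" by blast
      moreover have "\<forall>(u, v)\<in>arcs. {u, v} \<in> S \<union> T" using arcs by auto
      ultimately show False using cyc[of "S \<union> T"] T by blast
    qed
  qed simp
  also have "\<dots> \<le> real J * exp (- q * real s)"
    using finE \<F> q by (intro prob_miss_family) auto
  finally show "measure_pmf.prob (random_subset E q)
      {T. \<not> (\<exists>c. is_cycle (V, S \<union> T) c \<and> (M - 9) * s \<le> length c)} \<le> real J * exp (- q * real s)" .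
qed (use q in auto)

text \<open>Thin the edge set to a sparse \<open>E'\<close> of the same required minimum degree. The
  random subset of \<open>E'\<close> is the trace of that of \<open>E\<close>, and extra edges
  destroy no cycle.\<close>

lemma prob_long_cycle:
  fixes G :: "'a graph" and M s :: nat and q p :: real
  defines "J \<equiv> (M + 3) * M"
  defines "\<Delta> \<equiv> 2 * ((J + 1)\<^sup>2 * (M + 2))"
  assumes G: "finite_graph G" "M * s \<le> min_degree G" and p: "p = 1 - (1 - q)\<^sup>2"
    and s: "0 < s" and M: "11 \<le> M" and q: "0 < q" "q \<le> 1" "1 \<le> q * real (M * s)"
    and small: "q * real (M * s) * exp (2 - q * real s / \<Delta>) \<le> 1"
  shows "1 - (q * real (M * s) * exp (2 - q * real s / \<Delta>) + real J * exp (- q * real s))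
    \<le> measure_pmf.prob (random_subgraph G p) {H. \<exists>c. is_cycle H c \<and> (M - 9) * s \<le> length c}"
proof -
  obtain V E where GVE: "G = (V, E)" by (cases G)
  have V: "finite V" "V \<noteq> {}" and E: "\<And>e. e \<in> E \<Longrightarrow> e \<subseteq> V \<and> card e = 2"
    using G(1) by (auto simp: finite_graph_def GVE)
  have finE: "finite E" by (rule finite_edges[OF V(1) E])
  have "M * s \<le> card {e \<in> E. v \<in> e}" if "v \<in> V" for v
  proof -
    have "min_degree G \<le> vertex_degree G v"
      unfolding min_degree_def using V that by (intro Min_le) (auto simp: GVE)
    then show ?thesis using G(2) by (simp add: vertex_degree_def GVE)
  qed
  then obtain E' where E': "E' \<subseteq> E" "\<forall>v\<in>V. M * s \<le> card {e \<in> E'. v \<in> e}"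
    "card E' \<le> card V * (M * s)"
    using ex_sparse_subgraph[OF V(1) E] by blast
  let ?good = "\<lambda>S. \<exists>c. is_cycle (V, S) c \<and> (M - 9) * s \<le> length c"
  have E'_edges: "e \<subseteq> V \<and> card e = 2" if "e \<in> E'" for e using E E'(1) that by blast
  have "measure_pmf.prob (random_subset E' p) {S. \<not> ?good S}
      \<le> q * real (M * s) * exp (2 - q * real s / \<Delta>) + real J * exp (- q * real s)"
    unfolding p J_def \<Delta>_def
    by (rule prob_no_long_cycle[OF V E'_edges _ E'(3) s M q small[unfolded \<Delta>_def J_def]])
      (use E'(2) in auto)
  then have "1 - (q * real (M * s) * exp (2 - q * real s / \<Delta>) + real J * exp (- q * real s))
      \<le> 1 - measure_pmf.prob (random_subset E' p) {S. \<not> ?good S}"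
    by simp
  also have "\<dots> = measure_pmf.prob (random_subset E' p) {S. ?good S}"
    by (subst measure_pmf.prob_compl[symmetric]) (auto intro: arg_cong[where f = "measure_pmf.prob _"])
  also have "\<dots> \<le> measure_pmf.prob (random_subset E p) {S. ?good S}"
    unfolding random_subset_Int[OF finE E'(1)] measure_map_pmf
    by (intro measure_pmf.finite_measure_mono) (auto intro: is_cycle_mono)
  also have "\<dots> = measure_pmf.prob (random_subgraph G p)
      {H. \<exists>c. is_cycle H c \<and> (M - 9) * s \<le> length c}"
    by (simp add: random_subgraph_eq GVE vimage_def)
  finally show ?thesis .
qed

section \<open>Choice of parameters and passage to the limit\<close>

theorem theorem1p3:
  fixes \<omega> :: "nat \<Rightarrow> real" and \<epsilon> :: real
    and G :: "nat \<Rightarrow> 'a graph" and p :: "nat \<Rightarrow> real"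
  assumes "filterlim \<omega> at_top sequentially"
    and "\<epsilon> > 0"
    and "\<And>k. k \<ge> 1 \<Longrightarrow> finite_graph (G k)"
    and "\<And>k. k \<ge> 1 \<Longrightarrow> min_degree (G k) \<ge> k"
    and "\<And>k. k \<ge> 1 \<Longrightarrow> 0 \<le> p k \<and> p k \<le> 1"
    and "\<And>k. k \<ge> 1 \<Longrightarrow> p k \<ge> \<omega> k / real k"
  shows "(\<lambda>k. measure_pmf.prob (random_subgraph (G k) (p k))
            {H. \<exists>c. is_cycle H c \<and> real (length c) \<ge> (1 - \<epsilon>) * real k}) \<longlonglongrightarrow> 1"
proof -
  \<comment> \<open>The slack costs \<open>9 * s\<close> in length and rounding \<open>k\<close>
    down to a multiple of \<open>M\<close> costs at most another \<open>s\<close>;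
    \<open>10 / \<epsilon> \<le> M\<close> makes this at most an \<open>\<epsilon>\<close>
    fraction.\<close>
  define M where "M = max 11 (nat \<lceil>10 / \<epsilon>\<rceil>)"
  define J where "J = (M + 3) * M"
  define \<Delta> where "\<Delta> = 2 * ((J + 1)\<^sup>2 * (M + 2))"
  define s where "s k = k div M" for k
  \<comment> \<open>Solves \<open>(1 - q)\<^sup>2 = 1 - p\<close>, so that two rounds with
    \<open>q\<close> make up one with \<open>p\<close>.\<close>
  define q where "q k = 1 - sqrt (1 - p k)" for k
  \<comment> \<open>With \<open>M\<close> fixed, \<open>q * s = y / M\<close>, so the whole error is
    a function of \<open>y\<close>.\<close>
  define y where "y k = q k * real (M * s k)" for k
  define err where "err y = y * exp (2 - y / (real M * real \<Delta>)) + real J * exp (- (y / real M))" for y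
  have M: "11 \<le> M" "10 \<le> \<epsilon> * real M"
  proof -
    have "10 / \<epsilon> \<le> real M" unfolding M_def by linarith
    then show "10 \<le> \<epsilon> * real M" using assms(2) by (simp add: field_simps)
  qed (simp add: M_def)
  have "0 < \<Delta>" by (simp add: \<Delta>_def)
  then have \<Delta>: "0 < real M * real \<Delta>" using M by simp
  have Ms: "real k - real M < real (M * s k)" "M * s k \<le> k" for k
  proof -
    have "k < M * s k + M" using M dividend_less_times_div[of M k] by (simp add: s_def add.commute)
    then show "real k - real M < real (M * s k)" by linarith
  qed (simp add: s_def)
  \<comment> \<open>Combines \<open>q \<ge> p / 2\<close> with
    \<open>M * s \<ge> k / 2\<close>.\<close>
  have y_ge: "\<omega> k / 4 \<le> y k" if k: "2 * M \<le> k" and "0 \<le> \<omega> k" for k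
  proof -
    have k1: "1 \<le> k" using k M by linarith
    have "sqrt (1 - p k) \<le> 1 - p k / 2"
      using assms(5)[OF k1] by (intro real_le_lsqrt) (auto simp: power2_eq_square field_simps)
    then have "\<omega> k / real k / 2 \<le> q k" using assms(6)[OF k1] by (simp add: q_def)
    moreover have "real k / 2 \<le> real (M * s k)" using Ms(1)[of k] k by linarith
    moreover have "0 \<le> q k" using assms(5)[OF k1] by (simp add: q_def)
    ultimately have "(\<omega> k / real k / 2) * (real k / 2) \<le> y k"
      unfolding y_def using that k1 by (intro mult_mono) auto
    then show ?thesis using k1 by simp
  qed
  have \<omega>_ev: "eventually (\<lambda>k. 4 \<le> \<omega> k) sequentially"
    using assms(1) by (simp add: filterlim_at_top)
  have y_lim: "filterlim y at_top sequentially"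
  proof (rule filterlim_at_top_mono)
    show "filterlim (\<lambda>k. \<omega> k / 4) at_top sequentially"
      using filterlim_tendsto_pos_mult_at_top[OF tendsto_const[of "1 / 4"] _ assms(1)] by simp
    show "\<forall>\<^sub>F k in sequentially. \<omega> k / 4 \<le> y k"
      using \<omega>_ev eventually_ge_at_top[of "2 * M"] by eventually_elim (use y_ge in auto)
  qed
  \<comment> \<open>Treated separately from \<open>err\<close> because this term must also fall
    below 1, as \<open>prob_long_cycle\<close> requires.\<close>
  have head: "((\<lambda>y. y * exp (2 - y / (real M * real \<Delta>))) \<longlongrightarrow> 0) at_top"
  proof -
    have "((\<lambda>y. y * exp (2 - y / c)) \<longlongrightarrow> 0) at_top" if "0 < c" for c :: real
      using that by real_asymp
    from this[OF \<Delta>] show ?thesis .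
  qed
  have "(err \<longlongrightarrow> 0) at_top"
  proof -
    have "((\<lambda>y. a * exp (- (y / c))) \<longlongrightarrow> 0) at_top" if "0 < c" for a c :: real
      using that by real_asymp
    from tendsto_add[OF head this[of "real M" "real J"]] M show ?thesis by (simp add: err_def[abs_def])
  qed
  then have "(\<lambda>k. err (y k)) \<longlonglongrightarrow> 0" using y_lim by (rule filterlim_compose)
  then have lim: "(\<lambda>k. 1 - err (y k)) \<longlonglongrightarrow> 1" by (auto intro: tendsto_eq_intros)
  have head_ev: "\<forall>\<^sub>F k in sequentially. y k * exp (2 - y k / (real M * real \<Delta>)) < 1"
    using filterlim_compose[OF head y_lim] by (rule order_tendstoD) simp
  have lower: "\<forall>\<^sub>F k in sequentially. 1 - err (y k) \<le>
      measure_pmf.prob (random_subgraph (G k) (p k))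
            {H. \<exists>c. is_cycle H c \<and> real (length c) \<ge> (1 - \<epsilon>) * real k}"
    using head_ev \<omega>_ev eventually_ge_at_top[of "2 * M * M"]
  proof eventually_elim
    case (elim k)
    have "2 * M * 1 \<le> 2 * M * M" using M by (intro mult_left_mono) auto
    then have k: "2 * M \<le> k" "1 \<le> k" using elim(3) M by linarith+
    have y1: "1 \<le> y k" using y_ge[OF k(1)] elim(2) by simp
    \<comment> \<open>This lets the rounding loss \<open>M\<close> be absorbed into one
      \<open>s k\<close> in the final length estimate.\<close>
    have s: "M \<le> s k"
    proof -
      have "M * M div M \<le> k div M" using elim(3) by (intro div_le_mono) simp
      then show ?thesis using M by (simp add: s_def)
    qed
    have qk: "0 < q k" "q k \<le> 1"
    proof -
      show "q k \<le> 1" using assms(5)[OF k(2)] by (simp add: q_def)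
      show "0 < q k"
      proof (rule ccontr)
        assume "\<not> 0 < q k"
        then have "y k \<le> 0" unfolding y_def by (intro mult_nonpos_nonneg) auto
        with y1 show False by simp
      qed
    qed
    have qs: "q k * real (s k) = y k / real M" using M by (simp add: y_def)
    have b: "q k * real (M * s k) * exp (2 - q k * real (s k) / real \<Delta>) =
        y k * exp (2 - y k / (real M * real \<Delta>))"
      unfolding y_def[symmetric] qs by simp
    have pk: "p k = 1 - (1 - q k)\<^sup>2" using assms(5)[OF k(2)] by (simp add: q_def)
    have small: "q k * real (M * s k) * exp (2 - q k * real (s k) / real \<Delta>) \<le> 1"
      unfolding b using elim(1) by simp
    have "1 - err (y k) = 1 - (q k * real (M * s k) * exp (2 - q k * real (s k) / real \<Delta>) +
        real J * exp (- q k * real (s k)))"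
      unfolding b by (simp add: err_def qs)
    also have "\<dots> \<le> measure_pmf.prob (random_subgraph (G k) (p k))
        {H. \<exists>c. is_cycle H c \<and> (M - 9) * s k \<le> length c}"
      unfolding \<Delta>_def J_def
    proof (rule prob_long_cycle[OF assms(3)[OF k(2)] _ pk _ M(1) qk _ small[unfolded \<Delta>_def J_def]])
      show "M * s k \<le> min_degree (G k)" using Ms(2) assms(4)[OF k(2)] by (rule order.trans)
      show "0 < s k" using s M(1) by linarith
      show "1 \<le> q k * real (M * s k)" using y1 by (simp only: y_def)
    qed
    also have "\<dots> \<le> measure_pmf.prob (random_subgraph (G k) (p k))
            {H. \<exists>c. is_cycle H c \<and> real (length c) \<ge> (1 - \<epsilon>) * real k}"
    proof -
      have "(1 - \<epsilon>) * real k \<le> real ((M - 9) * s k)"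
      \<comment> \<open>Multiplying the bound on \<open>k\<close> by \<open>1 - \<epsilon>\<close>
        needs a nonnegative factor; for \<open>\<epsilon> > 1\<close> the required length is not
        positive.\<close>
      proof (cases "\<epsilon> \<le> 1")
        case True
        have "real k \<le> real M * real (s k) + real M" using Ms(1)[of k] by simp
        then have "(1 - \<epsilon>) * real k \<le> (1 - \<epsilon>) * (real M * real (s k) + real M)"
          using True by (intro mult_left_mono) auto
        also have "\<dots> \<le> real M * real (s k) + real M - (\<epsilon> * real M) * real (s k)"
          using assms(2) by (simp add: algebra_simps)
        also have "\<dots> \<le> real M * real (s k) + real (s k) - 10 * real (s k)"
          using M s by (intro diff_mono add_left_mono mult_right_mono) auto
        also have "\<dots> = real ((M - 9) * s k)" using M by (simp add: of_nat_diff algebra_simps)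
        finally show ?thesis .
      next
        case False
        then have "(1 - \<epsilon>) * real k \<le> 0" by (intro mult_nonpos_nonneg) auto
        then show ?thesis by (rule order.trans) simp
      qed
      then have "(1 - \<epsilon>) * real k \<le> real n" if "(M - 9) * s k \<le> n" for n
        using of_nat_mono[OF that, where 'a = real] by linarith
      then show ?thesis by (intro measure_pmf.finite_measure_mono) auto
    qed
    finally show ?case .
  qed
  show ?thesis
    by (rule tendsto_sandwich[OF lower _ lim tendsto_const]) simp
qed

end
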